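(* Consider the downlink virtual-cell mmWave network model described in the context, with Nakagami small-scale fading: all fading powers $|\xi_k|^2$ are independent of each other and of everything else, with $|\xi_k|^2\sim\Gamma(N_{\rm L},1/N_{\rm L})$ (Gamma with shape $N_{\rm L}$ and scale $1/N_{\rm L}$, hence mean $1$) when the link is LOS (in particular for every serving AP $k=1,\dots,K$), and $|\xi_k|^2\sim\Gamma(N_{\rm N},1/N_{\rm N})$ when the link is NLOS, where $N_{\rm L},N_{\rm N}>0$. Put $F(N,x)=1-\frac{1}{(1+x/N)^N}$ and, for $s>0$, $$Q_{\rm L}(s)=2\pi\lambda\sum_{n=1}^{2}b_n\int_{r_K}^{\infty}F(N_{\rm L},s a_n C_{\rm L}x^{-\alpha_{\rm L}})\,p(x)\,x\,dx,$$ $$Q_{\rm N}(s)=2\pi\lambda\sum_{n=1}^{2}b_n\int_{r_K}^{\infty}F(N_{\rm N},s a_n C_{\rm N}x^{-\alpha_{\rm N}})\,(1-p(x))\,x\,dx.$$ Then for $\bm r=(r_1,\dots,r_K)$ with $0<r_1\le\cdots\le r_K$ the conditional ergodic capacity is $$C_{\rm cond}(\bm r)=\frac{1}{\ln 2}\int_0^\infty\frac{e^{-s\sigma^2}}{s}\,e^{-(Q_{\rm L}(s)+Q_{\rm N}(s))}\left(1-\prod_{k=1}^{K}\bigl(1-F(N_{\rm L},sMC_{\rm L}r_k^{-\alpha_{\rm L}})\bigr)\right)ds,$$ and the downlink ergodic capacity is $$C=\frac{(2\pi\lambda)^K}{\ln 2}\int\cdots\int_{\mathcal D} r_1\cdots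 r_K\,e^{-\pi\lambda r_K^2}\int_0^\infty\frac{e^{-s\sigma^2}}{s}\,e^{-(Q_{\rm L}(s)+Q_{\rm N}(s))}\left(1-\prod_{k=1}^{K}\bigl(1-F(N_{\rm L},sMC_{\rm L}r_k^{-\alpha_{\rm L}})\bigr)\right)ds\,d\bm r,$$ where $\mathcal D=\{0<r_1\le\cdots\le r_K\}$ and $d\bm r=dr_1\cdots dr_K$.
   Context: Parameters: density $\lambda>0$; integer $K\ge 1$; blockage parameter $\beta>0$ and LOS probability function $p(r)=e^{-\beta r}$; path loss exponents $\alpha_{\rm L},\alpha_{\rm N}>0$ and intercepts $C_{\rm L},C_{\rm N}>0$; main lobe gain $M>0$, sidelobe gain $m>0$, beamwidth $\theta_b\in(0,2\pi]$; noise power $\sigma^2>0$ (normalized by transmit power). Set $a_1=M$, $b_1=\theta_b/(2\pi)$, $a_2=m$, $b_2=1-\theta_b/(2\pi)$. Model. Access points (APs) form a homogeneous Poisson point process (PPP) of density $\lambda$ on $\mathbb R^2$; the typical user is at the origin. Order the APs by increasing distance $r_1\le r_2\le\cdots$ to the origin. The $K$ closest APs serve the user; all others interfere. The joint density of $(r_1,\dots,r_K)$ on $\mathcal D=\{0<r_1\le\cdots\le r_K\}$ is $f(\bm r)=(2\pi\lambda)^K r_1\cdots r_K e^{-\pi\lambda r_K^2}$. All serving APs are assumed to be line-of-sight (LOS), each with antenna gain $M$. Conditionally on $(r_1,\dots,r_K)$, the interfering APs are the points, outside the disc $\mathcal B(r_K)$ of radius $r_K$ centered at the origin, of two independent non-homogeneous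 PPPs: the LOS process $\Phi_{\rm L}$ with intensity $\lambda p(|x|)$ and the non-line-of-sight (NLOS) process $\Phi_{\rm N}$ with intensity $\lambda(1-p(|x|))$. The antenna gains $G_l$ of interfering APs are i.i.d. (and independent of everything else) with $\mathbb P(G_l=a_n)=b_n$, $n=1,2$. $|\xi_l|^2$ denotes the small-scale fading power of the link to AP $l$. The SINR is $$\gamma=\frac{\sum_{k=1}^K MC_{\rm L}r_k^{-\alpha_{\rm L}}|\xi_k|^2}{I_{\rm L}+I_{\rm N}+\sigma^2},\quad I_{\rm L}=\sum_{l\in\Phi_{\rm L},\,r_l>r_K}G_lC_{\rm L}r_l^{-\alpha_{\rm L}}|\xi_l|^2,\quad I_{\rm N}=\sum_{l\in\Phi_{\rm N},\,r_l>r_K}G_lC_{\rm N}r_l^{-\alpha_{\rm N}}|\xi_l|^2.$$ The conditional ergodic capacity $C_{\rm cond}(\bm r)$ is the conditional expectation of $\log_2(1+\gamma)$ given that the serving APs are at distances $\bm r=(r_1,\dots,r_K)$ (averaging over interfering AP locations, gains and fading). The ergodic capacity is $C=\mathbb E[\log_2(1+\gamma)]=\int\cdots\int_{\mathcal D}C_{\rm cond}(\bm r)f(\bm r)\,d\bm r$. Conventions: if $I_{\rm L}+I_{\rm N}=\infty$ then $\gamma=0$, and $e^{-\infty}=0$. *)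

theory Defs
  imports "HOL-Probability.Probability"
begin

section \<open>Point processes\<close>

text \<open>
  A point process on \<open>'p\<close> is given by a measurable enumeration
  \<open>X :: nat \<Rightarrow> 'w \<Rightarrow> 'p option\<close>: in the outcome \<open>\<omega>\<close> its points are the \<open>x\<close> with
  \<open>X l \<omega> = Some x\<close>, and \<open>X l \<omega> = None\<close> means that there is no point with label \<open>l\<close>.
  In this way finite and infinite processes are treated alike, and marks can be attached
  to labels.
\<close>

definition num_points :: "(nat \<Rightarrow> 'w \<Rightarrow> 'p option) \<Rightarrow> 'p set \<Rightarrow> 'w \<Rightarrow> enat" where
  "num_points X A \<omega> =
     (if finite {l. X l \<omega> \<in> Some ` A} then enat (card {l. X l \<omega> \<in> Some ` A}) else \<infinity>)"

definition point_event :: "'w measure \<Rightarrow> (nat \<Rightarrow> 'w \<Rightarrow> 'p option) \<Rightarrow> nat \<Rightarrow> 'p set \<Rightarrow> 'w set" where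
  "point_event P X l A = {\<omega> \<in> space P. X l \<omega> \<in> Some ` A}"

definition poisson_process ::
    "'w measure \<Rightarrow> 'p measure \<Rightarrow> (nat \<Rightarrow> 'w \<Rightarrow> 'p option) \<Rightarrow> bool" where
  "poisson_process P \<Lambda> X \<longleftrightarrow>
     (\<forall>l. \<forall>A\<in>sets \<Lambda>. point_event P X l A \<in> sets P) \<and>
     (\<forall>A\<in>sets \<Lambda>. emeasure \<Lambda> A < \<infinity> \<longrightarrow>
        (\<forall>n. measure P {\<omega> \<in> space P. num_points X A \<omega> = enat n} =
             measure \<Lambda> A ^ n / fact n * exp (- measure \<Lambda> A))) \<and>
     (\<forall>(A :: nat \<Rightarrow> 'p set) n. disjoint_family_on A {..<n} \<longrightarrow> (\<forall>i<n. A i \<in> sets \<Lambda>) \<longrightarrow>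
        prob_space.indep_vars P (\<lambda>_. count_space UNIV) (\<lambda>i. num_points X (A i)) {..<n})"

section \<open>The network model\<close>

datatype link = LOS | NLOS

fun link_prob :: "real \<Rightarrow> link \<Rightarrow> real \<Rightarrow> real" where
  "link_prob \<beta> LOS r = exp (- \<beta> * r)"
| "link_prob \<beta> NLOS r = 1 - exp (- \<beta> * r)"

definition gain_value :: "real \<Rightarrow> real \<Rightarrow> nat \<Rightarrow> real" where
  "gain_value Mg mg n = (if n = 1 then Mg else mg)"

definition gain_prob :: "real \<Rightarrow> nat \<Rightarrow> real" where
  "gain_prob \<theta> n = (if n = 1 then \<theta> / (2 * pi) else 1 - \<theta> / (2 * pi))"

definition gamma_density :: "real \<Rightarrow> real \<Rightarrow> real \<Rightarrow> real" where
  "gamma_density k \<theta> x =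
     (if x > 0 then x powr (k - 1) * exp (- x / \<theta>) / (Gamma k * \<theta> powr k) else 0)"

text \<open>
  Vectors \<open>(r\<^sub>1, \<dots>, r\<^sub>K)\<close> are functions on \<open>{1..K}\<close>, with \<open>d\<^bold>r\<close> the product
  measure of the Lebesgue measures.
\<close>

abbreviation dist_space :: "nat \<Rightarrow> (nat \<Rightarrow> real) measure" where
  "dist_space K \<equiv> \<Pi>\<^sub>M k\<in>{1..K}. lborel"

definition ordered_dists :: "nat \<Rightarrow> (nat \<Rightarrow> real) set" where
  "ordered_dists K = {r. 0 < r 1 \<and> (\<forall>i\<in>{1..K}. \<forall>j\<in>{1..K}. i \<le> j \<longrightarrow> r i \<le> r j)}"

definition dist_density :: "real \<Rightarrow> nat \<Rightarrow> (nat \<Rightarrow> real) \<Rightarrow> real" where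
  "dist_density lam K r = indicator (ordered_dists K) r *
     ((2 * pi * lam) ^ K * (\<Prod>k=1..K. r k) * exp (- pi * lam * (r K)\<^sup>2))"

definition serving_dists :: "nat \<Rightarrow> (nat \<Rightarrow> 'w \<Rightarrow> real ^ 2) \<Rightarrow> 'w \<Rightarrow> nat \<Rightarrow> real" where
  "serving_dists K AP \<omega> = (\<lambda>k\<in>{1..K}. norm (AP k \<omega>))"

datatype source =
  Distances | Points link | Serving_Fading nat | Gain link nat | Fading link nat

definition rv_events :: "'w measure \<Rightarrow> 'b measure \<Rightarrow> ('w \<Rightarrow> 'b) \<Rightarrow> 'w set set" where
  "rv_events P S Y = {Y -` A \<inter> space P | A. A \<in> sets S}"

fun source_events ::
    "'w measure \<Rightarrow> nat \<Rightarrow> (nat \<Rightarrow> 'w \<Rightarrow> real ^ 2) \<Rightarrow> (link \<Rightarrow> nat \<Rightarrow> 'w \<Rightarrow> (real ^ 2) option) \<Rightarrow>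
     (nat \<Rightarrow> 'w \<Rightarrow> real) \<Rightarrow> (link \<Rightarrow> nat \<Rightarrow> 'w \<Rightarrow> real) \<Rightarrow> (link \<Rightarrow> nat \<Rightarrow> 'w \<Rightarrow> real) \<Rightarrow>
     source \<Rightarrow> 'w set set" where
  "source_events P K AP X h G H Distances = rv_events P (dist_space K) (serving_dists K AP)"
| "source_events P K AP X h G H (Points t) =
     sigma_sets (space P) {point_event P (X t) l A | l A. A \<in> sets borel}"
| "source_events P K AP X h G H (Serving_Fading k) = rv_events P borel (h k)"
| "source_events P K AP X h G H (Gain t l) = rv_events P borel (G t l)"
| "source_events P K AP X h G H (Fading t l) = rv_events P borel (H t l)"

text \<open>
  Random elements: \<open>AP l\<close> (\<open>l \<ge> 1\<close>) is the \<open>l\<close>-th closest access point and \<open>h k\<close> the fading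
  power of the serving link \<open>k \<le> K\<close>. \<open>X LOS\<close> and \<open>X NLOS\<close> are the processes
  \<open>\<Phi>\<^sub>L\<close> and \<open>\<Phi>\<^sub>N\<close> on the whole plane; the point of \<open>X t\<close> with label \<open>l\<close> has antenna
  gain \<open>G t l\<close> and fading power \<open>H t l\<close>. The interferers are the points of \<open>X LOS\<close> and \<open>X NLOS\<close>
  outside the disc of radius \<open>r\<^sub>K\<close>, and these are the access points outside that disc. Their
  conditional law given the serving distances is expressed by making \<open>X LOS\<close> and \<open>X NLOS\<close>
  independent of these distances; the points of \<open>X t\<close> inside the disc are never used.
  The gain law is stated as a measure because \<open>Mg = mg\<close> is allowed.
\<close>

locale virtual_cell_network = prob_space P
  for P :: "'w measure" +
  fixes lam \<beta> :: real and K :: nat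
    and Mg mg \<theta> :: real and N :: "link \<Rightarrow> real"
    and AP :: "nat \<Rightarrow> 'w \<Rightarrow> real ^ 2"
    and X :: "link \<Rightarrow> nat \<Rightarrow> 'w \<Rightarrow> (real ^ 2) option"
    and h :: "nat \<Rightarrow> 'w \<Rightarrow> real"
    and G H :: "link \<Rightarrow> nat \<Rightarrow> 'w \<Rightarrow> real"
  assumes AP_measurable: "\<And>l. AP l \<in> borel_measurable P"
    and AP_poisson:
      "poisson_process P (density lborel (\<lambda>_. ennreal lam)) (\<lambda>l \<omega>. Some (AP (Suc l) \<omega>))"
    and AP_ordered: "AE \<omega> in P. \<forall>l\<ge>1. norm (AP l \<omega>) \<le> norm (AP (Suc l) \<omega>)"
    and dists_distributed:
      "distributed P (dist_space K) (serving_dists K AP) (\<lambda>r. ennreal (dist_density lam K r))"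
    and X_poisson: "\<And>t. poisson_process P
          (density lborel (\<lambda>x. ennreal (lam * link_prob \<beta> t (norm x)))) (X t)"
    and interferers: "AE \<omega> in P. \<forall>A\<in>sets borel. A \<inter> cball 0 (norm (AP K \<omega>)) = {} \<longrightarrow>
          num_points (\<lambda>l \<omega>. Some (AP (Suc l) \<omega>)) A \<omega> =
          num_points (X LOS) A \<omega> + num_points (X NLOS) A \<omega>"
    and gain_distribution: "\<And>t l A. A \<in> sets borel \<Longrightarrow>
          measure P (G t l -` A \<inter> space P) =
          (\<Sum>n=1..2. gain_prob \<theta> n * indicator A (gain_value Mg mg n))"
    and serving_fading_distributed: "\<And>k. k \<in> {1..K} \<Longrightarrow>
          distributed P lborel (h k) (\<lambda>x. ennreal (gamma_density (N LOS) (1 / N LOS) x))"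
    and fading_distributed: "\<And>t l.
          distributed P lborel (H t l) (\<lambda>x. ennreal (gamma_density (N t) (1 / N t) x))"
    and independent: "indep_sets (source_events P K AP X h G H)
          {i. \<forall>k. i = Serving_Fading k \<longrightarrow> k \<in> {1..K}}"

section \<open>SINR and ergodic capacity\<close>

text \<open>
  The argument \<open>r\<close> is the vector of serving distances. Interference is an extended real,
  since it is infinite almost surely for some path loss exponents.
\<close>

definition interference ::
    "nat \<Rightarrow> (link \<Rightarrow> real) \<Rightarrow> (link \<Rightarrow> real) \<Rightarrow> (link \<Rightarrow> nat \<Rightarrow> 'w \<Rightarrow> (real ^ 2) option) \<Rightarrow>
     (link \<Rightarrow> nat \<Rightarrow> 'w \<Rightarrow> real) \<Rightarrow> (link \<Rightarrow> nat \<Rightarrow> 'w \<Rightarrow> real) \<Rightarrow>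
     link \<Rightarrow> (nat \<Rightarrow> real) \<Rightarrow> 'w \<Rightarrow> ennreal" where
  "interference K \<alpha> C X G H t r \<omega> =
     (\<Sum>l. case X t l \<omega> of
            None \<Rightarrow> 0
          | Some x \<Rightarrow> if norm x > r K
                      then ennreal (G t l \<omega> * C t * norm x powr (- \<alpha> t) * H t l \<omega>) else 0)"

definition sinr ::
    "nat \<Rightarrow> (link \<Rightarrow> real) \<Rightarrow> (link \<Rightarrow> real) \<Rightarrow> real \<Rightarrow> real \<Rightarrow>
     (link \<Rightarrow> nat \<Rightarrow> 'w \<Rightarrow> (real ^ 2) option) \<Rightarrow> (nat \<Rightarrow> 'w \<Rightarrow> real) \<Rightarrow>
     (link \<Rightarrow> nat \<Rightarrow> 'w \<Rightarrow> real) \<Rightarrow> (link \<Rightarrow> nat \<Rightarrow> 'w \<Rightarrow> real) \<Rightarrow>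
     (nat \<Rightarrow> real) \<Rightarrow> 'w \<Rightarrow> real" where
  "sinr K \<alpha> C Mg \<sigma> X h G H r \<omega> =
     (let I = interference K \<alpha> C X G H LOS r \<omega> + interference K \<alpha> C X G H NLOS r \<omega>
      in if I = \<infinity> then 0
         else (\<Sum>k=1..K. Mg * C LOS * r k powr (- \<alpha> LOS) * h k \<omega>) / (enn2real I + \<sigma>\<^sup>2))"

text \<open>
  Capacities are expectations of nonnegative variables and are taken in \<open>[0, \<infinity>]\<close>, so that
  no integrability caveat is needed. In \<open>cond_capacity\<close> the serving distances are frozen at \<open>r\<close>
  and everything else is averaged; the two theorems at the end of this theory show that this is a
  version of the conditional expectation given the serving distances, and that
  \<open>ergodic_capacity\<close> is its integral against the density of the serving distances.
\<close>

definition cond_capacity ::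
    "'w measure \<Rightarrow> nat \<Rightarrow> (link \<Rightarrow> real) \<Rightarrow> (link \<Rightarrow> real) \<Rightarrow> real \<Rightarrow> real \<Rightarrow>
     (link \<Rightarrow> nat \<Rightarrow> 'w \<Rightarrow> (real ^ 2) option) \<Rightarrow> (nat \<Rightarrow> 'w \<Rightarrow> real) \<Rightarrow>
     (link \<Rightarrow> nat \<Rightarrow> 'w \<Rightarrow> real) \<Rightarrow> (link \<Rightarrow> nat \<Rightarrow> 'w \<Rightarrow> real) \<Rightarrow>
     (nat \<Rightarrow> real) \<Rightarrow> ennreal" where
  "cond_capacity P K \<alpha> C Mg \<sigma> X h G H r =
     (\<integral>\<^sup>+\<omega>. ennreal (log 2 (1 + sinr K \<alpha> C Mg \<sigma> X h G H r \<omega>)) \<partial>P)"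

definition ergodic_capacity ::
    "'w measure \<Rightarrow> nat \<Rightarrow> (link \<Rightarrow> real) \<Rightarrow> (link \<Rightarrow> real) \<Rightarrow> real \<Rightarrow> real \<Rightarrow>
     (nat \<Rightarrow> 'w \<Rightarrow> real ^ 2) \<Rightarrow> (link \<Rightarrow> nat \<Rightarrow> 'w \<Rightarrow> (real ^ 2) option) \<Rightarrow>
     (nat \<Rightarrow> 'w \<Rightarrow> real) \<Rightarrow> (link \<Rightarrow> nat \<Rightarrow> 'w \<Rightarrow> real) \<Rightarrow> (link \<Rightarrow> nat \<Rightarrow> 'w \<Rightarrow> real) \<Rightarrow>
     ennreal" where
  "ergodic_capacity P K \<alpha> C Mg \<sigma> AP X h G H =
     (\<integral>\<^sup>+\<omega>. ennreal (log 2 (1 + sinr K \<alpha> C Mg \<sigma> X h G H (serving_dists K AP \<omega>) \<omega>)) \<partial>P)"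

definition nakagami_F :: "real \<Rightarrow> real \<Rightarrow> real" where
  "nakagami_F n x = 1 - 1 / (1 + x / n) powr n"

text \<open>\<open>Q_integral \<dots> LOS\<close> and \<open>Q_integral \<dots> NLOS\<close> are \<open>Q\<^sub>L\<close> and \<open>Q\<^sub>N\<close>;
  \<open>Q\<^sub>N\<close> is infinite when \<open>\<alpha> NLOS \<le> 2\<close>.\<close>

definition Q_integral ::
    "real \<Rightarrow> real \<Rightarrow> nat \<Rightarrow> (link \<Rightarrow> real) \<Rightarrow> (link \<Rightarrow> real) \<Rightarrow> real \<Rightarrow> real \<Rightarrow> real \<Rightarrow>
     (link \<Rightarrow> real) \<Rightarrow> link \<Rightarrow> (nat \<Rightarrow> real) \<Rightarrow> real \<Rightarrow> ennreal" where
  "Q_integral lam \<beta> K \<alpha> C Mg mg \<theta> N t r s =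
     ennreal (2 * pi * lam) * (\<Sum>n=1..2. ennreal (gain_prob \<theta> n) *
       (\<integral>\<^sup>+x\<in>{r K<..}. ennreal (nakagami_F (N t) (s * gain_value Mg mg n * C t * x powr (- \<alpha> t))
                              * link_prob \<beta> t x * x) \<partial>lborel))"

definition exp_minus :: "ennreal \<Rightarrow> real" where
  "exp_minus x = (if x = \<infinity> then 0 else exp (- enn2real x))"

section \<open>Conditional expectation given the serving distances\<close>

context virtual_cell_network
begin

context
  notes One_nat_def [simp del]
begin

definition other_sources :: "'w measure" where
  "other_sources = sigma (space P)
     (\<Union>i\<in>{i. \<forall>k. i = Serving_Fading k \<longrightarrow> k \<in> {1..K}} - {Distances}.
        source_events P K AP X h G H i)"

lemma source_events_subset: "source_events P K AP X h G H i \<subseteq> Pow (space P)"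
  by (cases i) (auto simp: rv_events_def point_event_def dest: sigma_sets_into_sp[rotated])

lemma space_other_sources [simp]: "space other_sources = space P"
  by (simp add: other_sources_def space_measure_of_conv)

lemma source_event_in_other_sources:
  assumes "E \<in> source_events P K AP X h G H i" "i \<noteq> Distances"
    "\<And>k. i = Serving_Fading k \<Longrightarrow> k \<in> {1..K}"
  shows "E \<in> sets other_sources"
proof -
  have "(\<Union>i\<in>{i. \<forall>k. i = Serving_Fading k \<longrightarrow> k \<in> {1..K}} - {Distances}.
        source_events P K AP X h G H i) \<subseteq> Pow (space P)"
    using source_events_subset by blast
  then show ?thesis
    unfolding other_sources_def using assms by (subst sets_measure_of) auto
qed

lemma rv_measurable_other_sources:
  fixes Y :: "'w \<Rightarrow> real"
  assumes "rv_events P borel Y = source_events P K AP X h G H i" "i \<noteq> Distances"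
    "\<And>k. i = Serving_Fading k \<Longrightarrow> k \<in> {1..K}"
  shows "Y \<in> borel_measurable other_sources"
proof (rule measurableI)
  fix A :: "real set" assume "A \<in> sets borel"
  then have "Y -` A \<inter> space P \<in> rv_events P borel Y"
    by (auto simp: rv_events_def)
  then show "Y -` A \<inter> space other_sources \<in> sets other_sources"
    using source_event_in_other_sources[of _ i] assms by auto
qed auto

lemma point_event_in_other_sources:
  assumes "A \<in> sets borel"
  shows "point_event P (X t) l A \<in> sets other_sources"
proof (rule source_event_in_other_sources[where i = "Points t"])
  show "point_event P (X t) l A \<in> source_events P K AP X h G H (Points t)"
    using assms by auto
qed auto

lemma sinr_measurable:
  assumes "K \<ge> 1"
  shows "(\<lambda>(r, \<omega>). sinr K \<alpha> C Mg \<sigma> X h G H r \<omega>)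
     \<in> borel_measurable (dist_space K \<Otimes>\<^sub>M other_sources)"
proof -
  let ?S = "dist_space K \<Otimes>\<^sub>M other_sources"
  have rk: "(\<lambda>z. fst z k) \<in> borel_measurable ?S" if "k \<in> {1..K}" for k
  proof -
    have "(\<lambda>z. fst z k) \<in> measurable ?S lborel"
      by (rule measurable_compose[OF measurable_fst measurable_component_singleton[OF that]])
    then show ?thesis
      by simp
  qed
  have snd: "f \<in> borel_measurable other_sources \<Longrightarrow> (\<lambda>z. f (snd z)) \<in> borel_measurable ?S"
    for f :: "'w \<Rightarrow> 'x :: topological_space"
    using measurable_compose[OF measurable_snd] by blast
  have h: "(\<lambda>z. h k (snd z)) \<in> borel_measurable ?S" if "k \<in> {1..K}" for k
    by (rule snd, rule rv_measurable_other_sources[where i = "Serving_Fading k"]) (use that in auto)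
  have G [measurable]: "(\<lambda>z. G t l (snd z)) \<in> borel_measurable ?S" for t l
    by (rule snd, rule rv_measurable_other_sources[where i = "Gain t l"]) auto
  have H [measurable]: "(\<lambda>z. H t l (snd z)) \<in> borel_measurable ?S" for t l
    by (rule snd, rule rv_measurable_other_sources[where i = "Fading t l"]) auto
  define loc where "loc t l \<omega> = (case X t l \<omega> of None \<Rightarrow> 0 | Some x \<Rightarrow> x)" for t l \<omega>
  have loc: "loc t l \<in> borel_measurable other_sources" for t l
  proof (rule measurableI)
    fix A :: "(real ^ 2) set" assume A: "A \<in> sets borel"
    have "loc t l -` A \<inter> space other_sources =
        (if 0 \<in> A then point_event P (X t) l A \<union> (space other_sources - point_event P (X t) l UNIV)
         else point_event P (X t) l A)"
      by (auto simp: loc_def point_event_def split: option.splits)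
    then show "loc t l -` A \<inter> space other_sources \<in> sets other_sources"
      using sets.Un[OF point_event_in_other_sources[OF A, of t l]
          sets.compl_sets[OF point_event_in_other_sources[of UNIV t l]]]
        point_event_in_other_sources[OF A, of t l] by simp
  qed auto
  have loc' [measurable]: "(\<lambda>z. loc t l (snd z)) \<in> borel_measurable ?S" for t l
    by (rule snd[OF loc])
  have "Measurable.pred other_sources (\<lambda>\<omega>. X t l \<omega> \<noteq> None)" for t l
  proof -
    have "{\<omega> \<in> space other_sources. X t l \<omega> \<noteq> None} = point_event P (X t) l UNIV"
      by (auto simp: point_event_def)
    then show ?thesis
      using point_event_in_other_sources[of UNIV t l] by (simp add: pred_def)
  qed
  then have pres [measurable]: "Measurable.pred ?S (\<lambda>z. X t l (snd z) \<noteq> None)" for t l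
    using measurable_compose[OF measurable_snd] by blast
  have [measurable]: "(\<lambda>z. fst z K) \<in> borel_measurable ?S"
    using rk assms by simp
  have "(\<lambda>z. interference K \<alpha> C X G H t (fst z) (snd z)) = (\<lambda>z. \<Sum>l.
      if X t l (snd z) \<noteq> None \<and> norm (loc t l (snd z)) > fst z K
      then ennreal (G t l (snd z) * C t * norm (loc t l (snd z)) powr (- \<alpha> t) * H t l (snd z))
      else 0)" for t
    by (auto simp: interference_def loc_def fun_eq_iff split: option.splits intro!: suminf_cong)
  moreover have "\<dots> t \<in> borel_measurable ?S" for t
    by measurable
  ultimately have [measurable]:
      "(\<lambda>z. interference K \<alpha> C X G H t (fst z) (snd z)) \<in> borel_measurable ?S" for t
    by metis
  have [measurable]: "(\<lambda>z. \<Sum>k=1..K. Mg * C LOS * fst z k powr (- \<alpha> LOS) * h k (snd z))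
      \<in> borel_measurable ?S"
  proof (rule borel_measurable_sum)
    fix k assume k: "k \<in> {1..K}"
    note [measurable] = rk[OF k] h[OF k]
    show "(\<lambda>z. Mg * C LOS * fst z k powr (- \<alpha> LOS) * h k (snd z)) \<in> borel_measurable ?S"
      by measurable
  qed
  show ?thesis
    unfolding sinr_def Let_def split_beta by measurable
qed

lemma serving_dists_measurable: "serving_dists K AP \<in> measurable P (dist_space K)"
  using dists_distributed by (rule distributed_measurable)

lemma Int_stable_rv_events: "Int_stable (rv_events P S Y)"
proof (rule Int_stableI)
  fix a b assume "a \<in> rv_events P S Y" "b \<in> rv_events P S Y"
  then obtain A B where "A \<in> sets S" "B \<in> sets S"
    "a = Y -` A \<inter> space P" "b = Y -` B \<inter> space P"
    by (auto simp: rv_events_def)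
  then show "a \<inter> b \<in> rv_events P S Y"
    by (auto simp: rv_events_def intro!: exI[of _ "A \<inter> B"])
qed

lemma measurable_other_sources_id: "(\<lambda>\<omega>. \<omega>) \<in> measurable P other_sources"
  and indep_dists_others:
    "indep_set (rv_events P (dist_space K) (serving_dists K AP)) (sets other_sources)"
proof -
  let ?I = "{i. \<forall>k. i = Serving_Fading k \<longrightarrow> k \<in> {1..K}}"
  let ?E = "source_events P K AP X h G H"
  have sub: "(\<Union>i\<in>?I - {Distances}. ?E i) \<subseteq> Pow (space P)"
    using source_events_subset by blast
  have stable: "Int_stable (?E i)" for i
  proof -
    have "Int_stable (?E (Points t))" for t
    proof -
      have "{point_event P (X t) l A |l A. A \<in> sets borel} \<subseteq> Pow (space P)"
        by (auto simp: point_event_def)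
      then have "sigma_algebra (space P) (?E (Points t))"
        by (simp add: sigma_algebra_sigma_sets)
      then show ?thesis
        by (intro Int_stableI) (metis sigma_algebra_def algebra.axioms(1) ring_of_sets_def
            semiring_of_sets_def semiring_of_sets.Int sigma_algebra.axioms(1) algebra_def
            ring_of_sets.axioms(1))
    qed
    then show ?thesis
      by (cases i) (auto simp: Int_stable_rv_events)
  qed
  have ev: "?E i \<subseteq> events" if "i \<in> ?I" for i
    using independent that unfolding indep_sets_def by blast
  show id: "(\<lambda>\<omega>. \<omega>) \<in> measurable P other_sources"
    unfolding other_sources_def by (rule measurable_measure_of[OF sub]) (use ev in auto)
  have *: "indep_sets (\<lambda>j. sigma_sets (space P) (\<Union>i\<in>case_bool {Distances} (?I - {Distances}) j. ?E i)) UNIV"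
  proof (rule indep_sets_collect_sigma)
    have "(\<Union>j. case_bool {Distances} (?I - {Distances}) j) = ?I"
      by (auto simp: UNIV_bool split: bool.split)
    then show "indep_sets ?E (\<Union>j. case_bool {Distances} (?I - {Distances}) j)"
      using independent by simp
    show "disjoint_family (case_bool {Distances} (?I - {Distances}))"
      unfolding disjoint_family_on_def by (auto split: bool.split)
  qed (rule stable)
  have sets: "sets other_sources = sigma_sets (space P) (\<Union>i\<in>?I - {Distances}. ?E i)"
    unfolding other_sources_def using sub by simp
  have "indep_sets (case_bool (?E Distances) (sets other_sources)) UNIV"
    by (rule indep_sets_mono_sets[OF *]) (auto simp: sets split: bool.split)
  then show "indep_set (rv_events P (dist_space K) (serving_dists K AP)) (sets other_sources)"
    unfolding indep_set_def by simp
qed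

lemma nn_integral_serving_dists_others:
  assumes "f \<in> borel_measurable (dist_space K \<Otimes>\<^sub>M other_sources)"
  shows "(\<integral>\<^sup>+\<omega>. f (serving_dists K AP \<omega>, \<omega>) \<partial>P) =
         (\<integral>\<^sup>+\<omega>. (\<integral>\<^sup>+\<omega>'. f (serving_dists K AP \<omega>, \<omega>') \<partial>P) \<partial>P)"
proof -
  note [measurable] = assms serving_dists_measurable measurable_other_sources_id
  let ?D = "distr P (dist_space K) (serving_dists K AP)"
  let ?O = "distr P other_sources (\<lambda>\<omega>. \<omega>)"
  interpret O: prob_space ?O
    by (rule prob_space_distr) measurable
  interpret D: prob_space ?D
    by (rule prob_space_distr) measurable
  have eq: "?D \<Otimes>\<^sub>M ?O =
      distr P (dist_space K \<Otimes>\<^sub>M other_sources) (\<lambda>\<omega>. (serving_dists K AP \<omega>, \<omega>))"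
  proof (rule pair_measure_eqI)
    fix A B assume "A \<in> sets ?D" "B \<in> sets ?O"
    then have [measurable]: "A \<in> sets (dist_space K)" "B \<in> sets other_sources"
      by auto
    have B: "B \<inter> space P = B"
      using sets.sets_into_space[of B other_sources] by auto
    have "prob ((serving_dists K AP -` A \<inter> space P) \<inter> B) =
        prob (serving_dists K AP -` A \<inter> space P) * prob B"
    proof (rule indep_setD[OF indep_dists_others])
      show "serving_dists K AP -` A \<inter> space P \<in> rv_events P (dist_space K) (serving_dists K AP)"
        unfolding rv_events_def using \<open>A \<in> sets (dist_space K)\<close> by blast
    qed simp
    moreover have "(\<lambda>\<omega>. (serving_dists K AP \<omega>, \<omega>)) -` (A \<times> B) \<inter> space P =
        (serving_dists K AP -` A \<inter> space P) \<inter> B"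
      using sets.sets_into_space[of B other_sources] by auto
    ultimately show "emeasure ?D A * emeasure ?O B = emeasure (distr P
        (dist_space K \<Otimes>\<^sub>M other_sources) (\<lambda>\<omega>. (serving_dists K AP \<omega>, \<omega>))) (A \<times> B)"
      by (simp add: emeasure_distr B emeasure_eq_measure ennreal_mult[symmetric])
  qed (auto intro: D.sigma_finite_measure_axioms O.sigma_finite_measure_axioms
         cong: sets_pair_measure_cong)
  have "(\<integral>\<^sup>+\<omega>. f (serving_dists K AP \<omega>, \<omega>) \<partial>P) = (\<integral>\<^sup>+z. f z \<partial>(?D \<Otimes>\<^sub>M ?O))"
    unfolding eq by (subst nn_integral_distr) auto
  also have "\<dots> = (\<integral>\<^sup>+r. (\<integral>\<^sup>+\<omega>'. f (r, \<omega>') \<partial>?O) \<partial>?D)"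
    by (rule O.nn_integral_fst[symmetric]) simp
  also have "\<dots> = (\<integral>\<^sup>+\<omega>. (\<integral>\<^sup>+\<omega>'. f (serving_dists K AP \<omega>, \<omega>') \<partial>?O) \<partial>P)"
    by (rule nn_integral_distr) (auto intro!: O.borel_measurable_nn_integral)
  also have "\<dots> = (\<integral>\<^sup>+\<omega>. (\<integral>\<^sup>+\<omega>'. f (serving_dists K AP \<omega>, \<omega>') \<partial>P) \<partial>P)"
  proof (rule nn_integral_cong)
    fix \<omega> assume "\<omega> \<in> space P"
    then have [measurable]: "serving_dists K AP \<omega> \<in> space (dist_space K)"
      using serving_dists_measurable by (rule measurable_space[rotated])
    show "(\<integral>\<^sup>+\<omega>'. f (serving_dists K AP \<omega>, \<omega>') \<partial>?O) = (\<integral>\<^sup>+\<omega>'. f (serving_dists K AP \<omega>, \<omega>') \<partial>P)"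
      by (rule nn_integral_distr) auto
  qed
  finally show ?thesis .
qed

lemma cond_capacity_measurable:
  assumes "K \<ge> 1"
  shows "cond_capacity P K \<alpha> C Mg \<sigma> X h G H \<in> borel_measurable (dist_space K)"
proof -
  note [measurable] = sinr_measurable[OF assms] measurable_other_sources_id
  have "(\<lambda>(r, \<omega>). ennreal (log 2 (1 + sinr K \<alpha> C Mg \<sigma> X h G H r \<omega>)))
      \<in> borel_measurable (dist_space K \<Otimes>\<^sub>M P)"
  proof -
    have "(\<lambda>z. (fst z, snd z)) \<in> measurable (dist_space K \<Otimes>\<^sub>M P) (dist_space K \<Otimes>\<^sub>M other_sources)"
      by measurable
    from measurable_compose[OF this sinr_measurable[OF assms]] show ?thesis
      by (simp add: split_beta)
  qed
  then show ?thesis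
    unfolding cond_capacity_def by measurable
qed

theorem cond_capacity_eq_cond_exp:
  assumes "K \<ge> 1"
  shows "AE \<omega> in P. cond_capacity P K \<alpha> C Mg \<sigma> X h G H (serving_dists K AP \<omega>) =
     nn_cond_exp P (vimage_algebra (space P) (serving_dists K AP) (dist_space K))
       (\<lambda>\<omega>. ennreal (log 2 (1 + sinr K \<alpha> C Mg \<sigma> X h G H (serving_dists K AP \<omega>) \<omega>))) \<omega>"
proof -
  note [measurable] = serving_dists_measurable measurable_other_sources_id
    cond_capacity_measurable[OF assms]
  let ?V = "vimage_algebra (space P) (serving_dists K AP) (dist_space K)"
  define g where "g = (\<lambda>(r, \<omega>). ennreal (log 2 (1 + sinr K \<alpha> C Mg \<sigma> X h G H r \<omega>)))"
  have g [measurable]: "g \<in> borel_measurable (dist_space K \<Otimes>\<^sub>M other_sources)"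
    unfolding g_def using sinr_measurable[OF assms, of \<alpha> C \<sigma>] by (simp add: split_beta)
  have sp: "serving_dists K AP \<in> space P \<rightarrow> space (dist_space K)"
    by (intro funcsetI measurable_space[OF serving_dists_measurable])
  have "subalgebra P ?V"
    using measurable_sets[OF serving_dists_measurable]
    by (auto simp: subalgebra_def sets_vimage_algebra2[OF sp])
  then interpret S: finite_measure_subalgebra P ?V
    by unfold_locales
  show ?thesis
  proof (rule S.nn_cond_exp_charact)
    show "(\<lambda>\<omega>. cond_capacity P K \<alpha> C Mg \<sigma> X h G H (serving_dists K AP \<omega>)) \<in> borel_measurable ?V"
      using measurable_compose[OF measurable_vimage_algebra1[OF sp] cond_capacity_measurable[OF assms]] .
    have "(\<lambda>\<omega>. g (serving_dists K AP \<omega>, \<omega>)) \<in> borel_measurable P"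
      by measurable
    then show "(\<lambda>\<omega>. ennreal (log 2 (1 + sinr K \<alpha> C Mg \<sigma> X h G H (serving_dists K AP \<omega>) \<omega>)))
        \<in> borel_measurable P"
      by (simp add: g_def)
  next
    fix B assume "B \<in> sets ?V"
    then obtain A where A [measurable]: "A \<in> sets (dist_space K)"
      and B: "B = serving_dists K AP -` A \<inter> space P"
      by (auto simp: sets_vimage_algebra2[OF sp])
    have f: "(\<lambda>z. g z * indicator A (fst z)) \<in> borel_measurable (dist_space K \<Otimes>\<^sub>M other_sources)"
      by measurable
    have "(\<integral>\<^sup>+\<omega>\<in>B. ennreal (log 2 (1 + sinr K \<alpha> C Mg \<sigma> X h G H (serving_dists K AP \<omega>) \<omega>)) \<partial>P) =
        (\<integral>\<^sup>+\<omega>. g (serving_dists K AP \<omega>, \<omega>) * indicator A (serving_dists K AP \<omega>) \<partial>P)"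
      by (rule nn_integral_cong) (auto simp: g_def B indicator_def)
    also have "\<dots> = (\<integral>\<^sup>+\<omega>. (\<integral>\<^sup>+\<omega>'. g (serving_dists K AP \<omega>, \<omega>') *
        indicator A (serving_dists K AP \<omega>) \<partial>P) \<partial>P)"
      using nn_integral_serving_dists_others[OF f] by simp
    also have "\<dots> = (\<integral>\<^sup>+\<omega>\<in>B. cond_capacity P K \<alpha> C Mg \<sigma> X h G H (serving_dists K AP \<omega>) \<partial>P)"
      by (rule nn_integral_cong) (auto simp: g_def B indicator_def cond_capacity_def)
    finally show "(\<integral>\<^sup>+\<omega>\<in>B. ennreal (log 2 (1 + sinr K \<alpha> C Mg \<sigma> X h G H (serving_dists K AP \<omega>) \<omega>)) \<partial>P) =
        (\<integral>\<^sup>+\<omega>\<in>B. cond_capacity P K \<alpha> C Mg \<sigma> X h G H (serving_dists K AP \<omega>) \<partial>P)" .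
  qed
qed

theorem ergodic_capacity_eq_integral:
  assumes "K \<ge> 1"
  shows "ergodic_capacity P K \<alpha> C Mg \<sigma> AP X h G H =
     (\<integral>\<^sup>+r. ennreal (dist_density lam K r) * cond_capacity P K \<alpha> C Mg \<sigma> X h G H r \<partial>dist_space K)"
proof -
  define g where "g = (\<lambda>(r, \<omega>). ennreal (log 2 (1 + sinr K \<alpha> C Mg \<sigma> X h G H r \<omega>)))"
  have g: "g \<in> borel_measurable (dist_space K \<Otimes>\<^sub>M other_sources)"
    unfolding g_def using sinr_measurable[OF assms, of \<alpha> C \<sigma>] by (simp add: split_beta)
  have "ergodic_capacity P K \<alpha> C Mg \<sigma> AP X h G H =
      (\<integral>\<^sup>+\<omega>. cond_capacity P K \<alpha> C Mg \<sigma> X h G H (serving_dists K AP \<omega>) \<partial>P)"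
    using nn_integral_serving_dists_others[OF g]
    by (simp add: g_def ergodic_capacity_def cond_capacity_def)
  also have "\<dots> =
      (\<integral>\<^sup>+r. ennreal (dist_density lam K r) * cond_capacity P K \<alpha> C Mg \<sigma> X h G H r \<partial>dist_space K)"
    by (rule distributed_nn_integral[OF dists_distributed cond_capacity_measurable[OF assms], symmetric])
  finally show ?thesis .
qed

end

end

end

theory Submission
  imports Defs
begin

text \<open>
  For \<open>a > 0\<close> and \<open>S \<ge> 0\<close> one has \<open>ln (1 + S / a) = \<integral>\<^sub>0\<^sup>\<infinity> e\<^sup>-\<^sup>s\<^sup>a (1 - e\<^sup>-\<^sup>s\<^sup>S) / s ds\<close>. Applied with
  signal power \<open>S\<close> and \<open>a = I + \<sigma>\<^sup>2\<close>, it separates signal and interference, so that after Tonelli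
  only the Laplace transforms of \<open>S\<close> and \<open>I\<close> are needed. The former is a product of gamma transforms.
  For the latter, the marks (gain times fading) are integrated out one label at a time, which turns
  \<open>e\<^sup>-\<^sup>s\<^sup>I\<close> into a product of \<open>\<phi>\<close> over the points; the Laplace functional of the Poisson process and
  polar coordinates then give \<open>e\<^sup>-\<^sup>Q\<close>.
\<close>

section \<open>Laplace functional of a Poisson process\<close>

text \<open>Since interference may be infinite almost surely, it stays in \<open>ennreal\<close>
  throughout: \<open>exp_minus\<close> turns sums into products and sends infinity to 0, so small
  path loss exponents need no separate treatment. Marks are attached to the labels of an arbitrary
  enumeration. They are therefore averaged with the whole point process frozen, over finitely many
  labels; as all products lie in [0, 1], dominated convergence reaches the full series. The
  resulting product of \<phi> over the points is read as \<open>exp_minus\<close> of the sum of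
  \<open>- ln (\<phi> x)\<close>, an unmarked Laplace functional. This is why \<phi> must be shown
  to be strictly positive, which rests on the main lobe having positive probability. Fading powers
  are positive only almost surely, while \<open>ennreal\<close> truncates negative reals. Transforms
  are therefore written with \<open>max 0\<close>: they are then bounded by 1 in every outcome, and
  positivity of the fading enters only where the signal power is put into the logarithm.\<close>

lemma exp_minus_ennreal: "exp_minus (ennreal x) = exp (- max 0 x)"
  by (cases "x \<ge> 0") (auto simp: exp_minus_def max_def ennreal_neg)

lemma exp_minus_0 [simp]: "exp_minus 0 = 1"
  by (simp add: exp_minus_def)

lemma exp_minus_top [simp]: "exp_minus \<top> = 0"
  by (simp add: exp_minus_def)

lemma exp_minus_nonneg [simp]: "0 \<le> exp_minus x"
  by (simp add: exp_minus_def)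

lemma exp_minus_le_1 [simp]: "exp_minus x \<le> 1"
  by (simp add: exp_minus_def)

lemma exp_minus_add: "exp_minus (x + y) = exp_minus x * exp_minus y"
  by (cases x; cases y) (auto simp: exp_minus_ennreal simp flip: ennreal_plus exp_add)

lemma exp_minus_antimono: "x \<le> y \<Longrightarrow> exp_minus y \<le> exp_minus x"
  by (cases x; cases y) (auto simp: exp_minus_ennreal top_unique)

lemma exp_minus_sum: "exp_minus (\<Sum>i\<in>I. f i) = (\<Prod>i\<in>I. exp_minus (f i))"
  by (induction I rule: infinite_finite_induct) (auto simp: exp_minus_add)

lemma exp_minus_measurable [measurable]: "exp_minus \<in> borel_measurable borel"
  unfolding exp_minus_def by measurable

text \<open>Continuity also at infinity, so that partial sums of a divergent interference series are
  covered by the same limit.\<close>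

lemma tendsto_exp_minus:
  assumes "(f \<longlongrightarrow> x) F"
  shows "((\<lambda>i. exp_minus (f i)) \<longlongrightarrow> exp_minus x) F"
proof (cases "x = \<infinity>")
  case True
  show ?thesis
    unfolding True infinity_ennreal_def exp_minus_top
  proof (rule tendstoI)
    fix e :: real assume e: "e > 0"
    \<comment> \<open>\<open>exp (- y) < e\<close> holds once \<open>y > - ln e\<close>; the
      \<open>max 0\<close> keeps the threshold nonnegative, so the comparison in
      \<open>ennreal\<close> descends to the reals.\<close>
    have "eventually (\<lambda>i. f i > ennreal (max 0 (- ln e))) F"
      using assms True by (intro order_tendstoD) auto
    then show "eventually (\<lambda>i. dist (exp_minus (f i)) 0 < e) F"
    proof eventually_elim
      case (elim i)
      show ?case
      proof (cases "f i")
        case (real y)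
        then have "- ln e < y"
          using elim by (auto simp: ennreal_less_iff max_def split: if_splits)
        then have "exp (- y) < e"
          using e by (metis exp_less_mono exp_ln minus_less_iff)
        then show ?thesis
          using real by (simp add: exp_minus_ennreal)
      qed (use e in simp)
    qed
  qed
next
  case False
  have "((\<lambda>i. exp (- enn2real (f i))) \<longlongrightarrow> exp (- enn2real x)) F"
    using False assms by (intro tendsto_intros) (auto simp: less_top)
  moreover have "eventually (\<lambda>i. f i < \<infinity>) F"
    using assms False by (intro order_tendstoD) (auto simp: less_top)
  then have "eventually (\<lambda>i. exp (- enn2real (f i)) = exp_minus (f i)) F"
    by eventually_elim (auto simp: exp_minus_def)
  ultimately show ?thesis
    using False by (simp add: exp_minus_def tendsto_cong)
qed

section \<open>Counts of points and their transforms\<close>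

lemma suminf_indicator_eq_num_points:
  "(\<Sum>l. if X l \<omega> \<in> Some ` A then 1 else 0) = ennreal_of_enat (num_points X A \<omega>)"
proof -
  let ?L = "{l. X l \<omega> \<in> Some ` A}"
  have "(\<Sum>l. if X l \<omega> \<in> Some ` A then 1 else 0) = (\<integral>\<^sup>+l. indicator ?L l \<partial>count_space UNIV)"
    by (subst nn_integral_count_space_nat) (auto intro!: suminf_cong simp: indicator_def)
  also have "\<dots> = emeasure (count_space UNIV) ?L"
    by simp
  also have "\<dots> = ennreal_of_enat (num_points X A \<omega>)"
    by (simp add: emeasure_count_space num_points_def ennreal_of_nat_eq_real_of_nat)
  finally show ?thesis .
qed

text \<open>Weighting the Poisson probabilities with \<open>exp (- c) ^ n\<close> produces the
  exponential series at \<open>exp (- c) * m\<close>.\<close>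

lemma (in prob_space) expectation_exp_minus_poisson:
  fixes Y :: "'a \<Rightarrow> enat"
  assumes Y [measurable]: "Y \<in> measurable M (count_space UNIV)"
    and pois: "\<And>n. prob {\<omega>\<in>space M. Y \<omega> = enat n} = m ^ n / fact n * exp (- m)"
    and m: "m \<ge> 0" and c: "c \<ge> 0"
  shows "expectation (\<lambda>\<omega>. exp_minus (ennreal c * ennreal_of_enat (Y \<omega>))) = exp (- (m * (1 - exp (- c))))"
proof -
  let ?A = "\<lambda>n. {\<omega>\<in>space M. Y \<omega> = enat n}"
  have exps: "(\<lambda>n. x ^ n / fact n * exp (- m)) sums (exp x * exp (- m))" for x :: real
    using sums_mult2[OF exp_converges[of x], of "exp (- m)"] by (simp add: field_simps)
  \<comment> \<open>The assumed law concerns finite counts only; its weights already sum to 1, so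
    the value infinity is a null event.\<close>
  have "(\<lambda>n. prob (?A n)) sums prob (\<Union>n. ?A n)"
    by (rule finite_measure_UNION) (auto simp: disjoint_family_on_def)
  moreover have "(\<lambda>n. prob (?A n)) sums 1"
    using exps[of m] by (simp add: pois flip: exp_add)
  ultimately have "prob (\<Union>n. ?A n) = 1"
    using sums_unique2 by blast
  then have fin: "AE \<omega> in M. \<exists>n. Y \<omega> = enat n"
    by (subst (asm) prob_eq_1) auto
  have "(\<integral>\<^sup>+\<omega>. ennreal (exp_minus (ennreal c * ennreal_of_enat (Y \<omega>))) \<partial>M) =
      (\<integral>\<^sup>+\<omega>. (\<Sum>n. ennreal (exp (- c) ^ n) * indicator (?A n) \<omega>) \<partial>M)"
  proof (rule nn_integral_cong_AE, use fin AE_space in eventually_elim)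
    fix \<omega> assume *: "\<exists>n. Y \<omega> = enat n" "\<omega> \<in> space M"
    then obtain n where n: "Y \<omega> = enat n" by auto
    have "(\<Sum>k. ennreal (exp (- c) ^ k) * indicator (?A k) \<omega>) =
        (\<Sum>k\<in>{n}. ennreal (exp (- c) ^ k) * indicator (?A k) \<omega>)"
      by (rule suminf_finite) (auto simp: n)
    also have "\<dots> = ennreal (exp_minus (ennreal c * ennreal_of_enat (Y \<omega>)))"
      using * n c by (simp add: ennreal_of_nat_eq_real_of_nat exp_minus_ennreal
          exp_of_nat_mult[symmetric] max_def mult_ac flip: ennreal_mult)
    finally show "ennreal (exp_minus (ennreal c * ennreal_of_enat (Y \<omega>))) =
        (\<Sum>k. ennreal (exp (- c) ^ k) * indicator (?A k) \<omega>)" ..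
  qed
  also have "\<dots> = (\<Sum>n. ennreal (exp (- c) ^ n) * emeasure M (?A n))"
    by (subst nn_integral_suminf) (auto simp: nn_integral_cmult_indicator)
  also have "\<dots> = (\<Sum>n. ennreal ((exp (- c) * m) ^ n / fact n * exp (- m)))"
    using m by (simp add: emeasure_eq_measure pois power_mult_distrib mult_ac flip: ennreal_mult)
  also have "\<dots> = ennreal (exp (exp (- c) * m) * exp (- m))"
    using m by (intro suminf_ennreal_eq exps) auto
  also have "exp (exp (- c) * m) * exp (- m) = exp (- (m * (1 - exp (- c))))"
    by (simp add: field_simps flip: exp_add)
  finally show ?thesis
    by (intro integral_eq_nn_integral[THEN trans]) auto
qed


text \<open>The integral of \<open>g\<close> against the random counting measure of the process.
  Summing over labels counts coinciding points with multiplicity, in agreement with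
  \<open>num_points\<close>.\<close>

definition point_sum :: "(nat \<Rightarrow> 'w \<Rightarrow> 'p option) \<Rightarrow> ('p \<Rightarrow> ennreal) \<Rightarrow> 'w \<Rightarrow> ennreal" where
  "point_sum X g \<omega> = (\<Sum>l. case X l \<omega> of None \<Rightarrow> 0 | Some x \<Rightarrow> g x)"

lemma point_sum_indicator:
  "point_sum X (indicator A) \<omega> = ennreal_of_enat (num_points X A \<omega>)"
  unfolding suminf_indicator_eq_num_points[symmetric] point_sum_def
  by (intro suminf_cong) (auto simp: indicator_def image_iff split: option.splits)

lemma point_sum_cmult: "point_sum X (\<lambda>x. c * g x) \<omega> = c * point_sum X g \<omega>"
proof -
  have "point_sum X (\<lambda>x. c * g x) \<omega> = (\<Sum>l. c * (case X l \<omega> of None \<Rightarrow> 0 | Some x \<Rightarrow> g x))"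
    unfolding point_sum_def by (intro suminf_cong) (auto split: option.splits)
  then show ?thesis
    by (simp add: point_sum_def)
qed

lemma point_sum_sum: "point_sum X (\<lambda>x. \<Sum>i\<in>I. g i x) \<omega> = (\<Sum>i\<in>I. point_sum X (g i) \<omega>)"
proof -
  have "point_sum X (\<lambda>x. \<Sum>i\<in>I. g i x) \<omega> = (\<Sum>l. \<Sum>i\<in>I. case X l \<omega> of None \<Rightarrow> 0 | Some x \<Rightarrow> g i x)"
    unfolding point_sum_def by (intro suminf_cong) (auto split: option.splits)
  also have "\<dots> = (\<Sum>i\<in>I. \<Sum>l. case X l \<omega> of None \<Rightarrow> 0 | Some x \<Rightarrow> g i x)"
    by (rule suminf_sum) auto
  finally show ?thesis
    by (simp add: point_sum_def)
qed

lemma point_sum_SUP: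
  assumes "incseq f"
  shows "point_sum X (\<lambda>x. SUP i. f i x) \<omega> = (SUP i. point_sum X (f i) \<omega>)"
proof -
  have "point_sum X (\<lambda>x. SUP i. f i x) \<omega> = (\<Sum>l. SUP i. case X l \<omega> of None \<Rightarrow> 0 | Some x \<Rightarrow> f i x)"
    unfolding point_sum_def by (intro suminf_cong) (auto split: option.splits)
  also have "\<dots> = (SUP i. \<Sum>l. case X l \<omega> of None \<Rightarrow> 0 | Some x \<Rightarrow> f i x)"
    using assms
    by (intro ennreal_suminf_SUP_eq) (auto simp: incseq_def le_fun_def split: option.splits)
  finally show ?thesis
    by (simp add: point_sum_def)
qed

lemma point_sum_mono: "(\<And>x. f x \<le> g x) \<Longrightarrow> point_sum X f \<omega> \<le> point_sum X g \<omega>"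
  unfolding point_sum_def by (intro suminf_le) (auto split: option.splits)

text \<open>The level sets of \<open>f\<close> are disjoint, so the point sum is a linear
  combination of independent Poisson counts and its transform is a product of one-dimensional
  ones.\<close>

lemma (in prob_space) poisson_laplace_simple:
  assumes X: "poisson_process M \<Lambda> X" and sp: "space \<Lambda> = UNIV"
    and f: "simple_function \<Lambda> f" "\<And>x. f x < top"
    and fin: "emeasure \<Lambda> {x. f x \<noteq> 0} < \<infinity>"
  shows "point_sum X f \<in> borel_measurable M"
    and "expectation (\<lambda>\<omega>. exp_minus (point_sum X f \<omega>)) =
      exp_minus (\<integral>\<^sup>+x. ennreal (1 - exp_minus (f x)) \<partial>\<Lambda>)"
proof -
  have "finite (f ` UNIV - {0})"
    using f(1) sp by (auto simp: simple_function_def)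
  \<comment> \<open>The value 0 is left out: its level set may have infinite measure, where
    \<open>poisson_process\<close> prescribes no law for the count.\<close>
  then obtain v n where v: "bij_betw v {..<n::nat} (f ` UNIV - {0})"
    using ex_bij_betw_nat_finite by (metis lessThan_atLeast0)
  define A where "A i = {x. f x = v i}" for i
  define c where "c i = enn2real (v i)" for i
  have vi: "v i \<noteq> 0" "v i < top" "ennreal (c i) = v i" if "i < n" for i
  proof -
    have "v i \<in> f ` UNIV - {0}"
      using bij_betw_apply[OF v] that by simp
    then show "v i \<noteq> 0" "v i < top"
      using f(2) by auto
    then show "ennreal (c i) = v i"
      by (simp add: c_def)
  qed
  have v_eq: "v i = v j \<longleftrightarrow> i = j" if "i < n" "j < n" for i j
    using bij_betw_imp_inj_on[OF v] that by (simp add: inj_on_eq_iff)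
  have disj: "disjoint_family_on A {..<n}"
    unfolding disjoint_family_on_def
  proof (intro ballI impI)
    fix i j assume "i \<in> {..<n}" "j \<in> {..<n}" "i \<noteq> j"
    then have "v i \<noteq> v j"
      using v_eq by simp
    then show "A i \<inter> A j = {}"
      by (auto simp: A_def)
  qed
  have sets: "A i \<in> sets \<Lambda>" for i
    using simple_functionD(2)[OF f(1), of "{v i}"] sp by (simp add: A_def vimage_def)
  have Afin: "emeasure \<Lambda> (A i) < \<infinity>" if "i < n" for i
  proof (rule order.strict_trans1[OF emeasure_mono fin])
    show "A i \<subseteq> {x. f x \<noteq> 0}"
      using vi[OF that] by (auto simp: A_def)
    have "UNIV - f -` {0} \<inter> space \<Lambda> \<in> sets \<Lambda>"
      using simple_functionD(2)[OF f(1), of "{0}"] sets.compl_sets[of _ \<Lambda>] sp by simp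
    then show "{x. f x \<noteq> 0} \<in> sets \<Lambda>"
      by (rule back_subst[of "\<lambda>S. S \<in> sets \<Lambda>"]) (auto simp: sp)
  qed
  \<comment> \<open>Stated for a general \<open>g\<close> vanishing at 0 because it serves twice:
    with the identity for the point sum, and with \<open>1 - exp_minus y\<close> for the integral on
    the right-hand side.\<close>
  have f_eq: "g (f x) = (\<Sum>i<n. g (v i) * indicator (A i) x)" if "g 0 = 0" for x and g :: "ennreal \<Rightarrow> ennreal"
  proof (cases "f x = 0")
    case True
    then have "indicator (A i) x = (0 :: ennreal)" if "i < n" for i
      using vi(1)[OF that] by (simp add: A_def)
    then show ?thesis
      using True that by simp
  next
    case False
    then have "f x \<in> v ` {..<n}"
      using v by (simp add: bij_betw_def)
    then obtain j where j: "j < n" "v j = f x"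
      by auto
    have "(\<Sum>i<n. g (v i) * indicator (A i) x) = (\<Sum>i<n. if i = j then g (v i) else 0)"
      using v_eq j by (intro sum.cong) (auto simp: A_def indicator_def)
    then show ?thesis
      using j by simp
  qed
  have num: "num_points X (A i) \<in> measurable M (count_space UNIV)" if "i < n" for i
    using X disj sets that unfolding poisson_process_def indep_vars_def by blast
  have sum_eq: "point_sum X f \<omega> = (\<Sum>i<n. ennreal (c i) * ennreal_of_enat (num_points X (A i) \<omega>))" for \<omega>
  proof -
    have "f x = (\<Sum>i<n. ennreal (c i) * indicator (A i) x)" for x
      by (subst f_eq[of "\<lambda>x. x" x]) (use vi in \<open>auto intro!: sum.cong\<close>)
    then have "f = (\<lambda>x. \<Sum>i<n. ennreal (c i) * indicator (A i) x)"
      by blast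
    then have "point_sum X f \<omega> = point_sum X (\<lambda>x. \<Sum>i<n. ennreal (c i) * indicator (A i) x) \<omega>"
      by (rule arg_cong)
    also have "\<dots> = (\<Sum>i<n. ennreal (c i) * ennreal_of_enat (num_points X (A i) \<omega>))"
      by (simp only: point_sum_sum point_sum_cmult point_sum_indicator)
    finally show ?thesis .
  qed
  have num': "(\<lambda>\<omega>. g (num_points X (A i) \<omega>)) \<in> borel_measurable M" if "i < n"
    for i and g :: "enat \<Rightarrow> 'z :: topological_space"
    by (rule measurable_compose[OF num[OF that]]) simp
  have "(\<lambda>\<omega>. \<Sum>i<n. ennreal (c i) * ennreal_of_enat (num_points X (A i) \<omega>)) \<in> borel_measurable M"
    using num' by (intro borel_measurable_sum) auto
  then show "point_sum X f \<in> borel_measurable M"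
    using sum_eq by presburger
  have "indep_vars (\<lambda>_. count_space UNIV) (\<lambda>i. num_points X (A i)) {..<n}"
    using X disj sets unfolding poisson_process_def by blast
  then have ind: "indep_vars (\<lambda>_. borel)
      (\<lambda>i \<omega>. exp_minus (ennreal (c i) * ennreal_of_enat (num_points X (A i) \<omega>))) {..<n}"
    by (rule indep_vars_compose2[where X = "\<lambda>i. num_points X (A i)"
          and Y = "\<lambda>i N. exp_minus (ennreal (c i) * ennreal_of_enat N)"]) simp
  have int: "integrable M (\<lambda>\<omega>. exp_minus (ennreal (c i) * ennreal_of_enat (num_points X (A i) \<omega>)))"
    if "i < n" for i
    using num'[OF that] by (intro integrable_const_bound[of _ 1]) auto
  have "expectation (\<lambda>\<omega>. exp_minus (point_sum X f \<omega>)) =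
      (\<Prod>i<n. expectation (\<lambda>\<omega>. exp_minus (ennreal (c i) * ennreal_of_enat (num_points X (A i) \<omega>))))"
    unfolding sum_eq exp_minus_sum by (rule indep_vars_lebesgue_integral[OF _ ind int]) auto
  also have "\<dots> = (\<Prod>i<n. exp (- (measure \<Lambda> (A i) * (1 - exp (- c i)))))"
  proof (rule prod.cong)
    fix i assume i: "i \<in> {..<n}"
    show "expectation (\<lambda>\<omega>. exp_minus (ennreal (c i) * ennreal_of_enat (num_points X (A i) \<omega>))) =
        exp (- (measure \<Lambda> (A i) * (1 - exp (- c i))))"
      using i X sets Afin num
      by (intro expectation_exp_minus_poisson) (auto simp: poisson_process_def c_def)
  qed simp
  also have "\<dots> = exp (- (\<Sum>i<n. measure \<Lambda> (A i) * (1 - exp (- c i))))"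
    unfolding sum_negf[symmetric] by (simp add: exp_sum)
  also have "\<dots> = exp_minus (ennreal (\<Sum>i<n. measure \<Lambda> (A i) * (1 - exp (- c i))))"
    by (subst exp_minus_ennreal) (auto simp: max_def c_def intro: sum_nonneg antisym)
  also have "ennreal (\<Sum>i<n. measure \<Lambda> (A i) * (1 - exp (- c i))) =
      (\<Sum>i<n. ennreal (1 - exp_minus (v i)) * emeasure \<Lambda> (A i))"
  proof (subst sum_ennreal[symmetric], simp add: c_def, rule sum.cong)
    fix i assume i: "i \<in> {..<n}"
    then have "exp_minus (v i) = exp (- c i)"
      using vi[of i] by (auto simp: exp_minus_def c_def)
    moreover have "emeasure \<Lambda> (A i) = ennreal (measure \<Lambda> (A i))"
      using Afin[of i] i by (intro emeasure_eq_ennreal_measure) (auto simp: less_top)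
    ultimately show "ennreal (measure \<Lambda> (A i) * (1 - exp (- c i))) =
        ennreal (1 - exp_minus (v i)) * emeasure \<Lambda> (A i)"
      by (simp add: c_def mult.commute flip: ennreal_mult)
  qed simp
  also have "\<dots> = (\<integral>\<^sup>+x. (\<Sum>i<n. ennreal (1 - exp_minus (v i)) * indicator (A i) x) \<partial>\<Lambda>)"
    using sets by (subst nn_integral_sum) (auto simp: nn_integral_cmult_indicator)
  also have "\<dots> = (\<integral>\<^sup>+x. ennreal (1 - exp_minus (f x)) \<partial>\<Lambda>)"
    using f_eq[of "\<lambda>y. ennreal (1 - exp_minus y)"] by simp
  finally show "expectation (\<lambda>\<omega>. exp_minus (point_sum X f \<omega>)) =
      exp_minus (\<integral>\<^sup>+x. ennreal (1 - exp_minus (f x)) \<partial>\<Lambda>)" .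
qed

text \<open>Approximation from below by the simple case. The expectations converge by domination by
  1; the integrals converge monotonically, because \<open>1 - exp_minus y\<close> increases with
  \<open>y\<close>.\<close>

lemma (in prob_space) poisson_laplace:
  assumes X: "poisson_process M \<Lambda> X" and sp: "space \<Lambda> = UNIV" and sf: "sigma_finite_measure \<Lambda>"
    and g [measurable]: "g \<in> borel_measurable \<Lambda>"
  shows "point_sum X g \<in> borel_measurable M"
    and "expectation (\<lambda>\<omega>. exp_minus (point_sum X g \<omega>)) =
      exp_minus (\<integral>\<^sup>+x. ennreal (1 - exp_minus (g x)) \<partial>\<Lambda>)"
proof -
  interpret \<Lambda>: sigma_finite_measure \<Lambda> by fact
  obtain A :: "nat \<Rightarrow> 'b set" where A: "range A \<subseteq> sets \<Lambda>" "(\<Union>i. A i) = space \<Lambda>"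
    "\<And>i. emeasure \<Lambda> (A i) \<noteq> \<infinity>" "incseq A"
    using \<Lambda>.sigma_finite_incseq by blast
  have [measurable]: "A i \<in> sets \<Lambda>" for i using A(1) by auto
  obtain u where u: "\<And>i. simple_function \<Lambda> (u i)" "incseq u" "\<And>i x. u i x < top"
      "\<And>x. (SUP i. u i x) = g x"
    using borel_measurable_implies_simple_function_sequence'[OF g] by blast
  \<comment> \<open>Cutting off with an exhausting sequence of sets of finite measure gives each
    approximation the finite support that the simple case requires.\<close>
  define f where "f i x = u i x * indicator (A i) x" for i x
  have f: "simple_function \<Lambda> (f i)" for i
    unfolding f_def using u(1) by (intro simple_function_mult simple_function_indicator) auto
  have f_top: "f i x < top" for i x
    using u(3) by (auto simp: f_def indicator_def)
  have inc: "incseq f"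
    unfolding incseq_def le_fun_def f_def
  proof (intro allI impI mult_mono)
    fix i j :: nat and x assume "i \<le> j"
    show "u i x \<le> u j x"
      using \<open>i \<le> j\<close> u(2) by (auto simp: incseq_def le_fun_def)
    show "indicator (A i) x \<le> (indicator (A j) x :: ennreal)"
      using \<open>i \<le> j\<close> A(4) by (auto simp: incseq_def indicator_def)
  qed auto
  have f_fin: "emeasure \<Lambda> {x. f i x \<noteq> 0} < \<infinity>" for i
  proof (rule order.strict_trans1[OF emeasure_mono])
    show "{x. f i x \<noteq> 0} \<subseteq> A i"
      by (auto simp: f_def indicator_def)
    show "emeasure \<Lambda> (A i) < \<infinity>"
      using A(3)[of i] by (simp add: top.not_eq_extremum)
  qed simp
  have sup: "(SUP i. f i x) = g x" for x
  proof (rule antisym)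
    show "(SUP i. f i x) \<le> g x"
      unfolding u(4)[symmetric] by (intro SUP_mono) (auto simp: f_def indicator_def)
    obtain m where m: "x \<in> A m"
      using A(2) sp by auto
    \<comment> \<open>The index \<open>max i m\<close> is late enough both for the height
      \<open>u i x\<close> and for \<open>x\<close> to lie in the cut-off set.\<close>
    have "u i x \<le> (SUP i. f i x)" for i
    proof (rule SUP_upper2)
      have "x \<in> A (max i m)"
        using m A(4) by (meson incseqD max.cobounded2 subsetD)
      then show "u i x \<le> f (max i m) x"
        using u(2) by (simp add: f_def incseq_def le_fun_def)
    qed simp
    then show "g x \<le> (SUP i. f i x)"
      unfolding u(4)[symmetric] by (intro SUP_least)
  qed
  have meas: "point_sum X (f i) \<in> borel_measurable M" for i
    by (rule poisson_laplace_simple[OF X sp f f_top f_fin])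
  have eq: "expectation (\<lambda>\<omega>. exp_minus (point_sum X (f i) \<omega>)) =
      exp_minus (\<integral>\<^sup>+x. ennreal (1 - exp_minus (f i x)) \<partial>\<Lambda>)" for i
    by (rule poisson_laplace_simple[OF X sp f f_top f_fin])
  have "point_sum X g = (\<lambda>\<omega>. SUP i. point_sum X (f i) \<omega>)"
    by (simp add: sup flip: point_sum_SUP[OF inc])
  then show meas_g: "point_sum X g \<in> borel_measurable M"
    using meas by (simp add: borel_measurable_SUP)
  have lim: "(\<lambda>i. point_sum X (f i) \<omega>) \<longlonglongrightarrow> point_sum X g \<omega>" for \<omega>
  proof -
    have "incseq (\<lambda>i. point_sum X (f i) \<omega>)"
      using inc by (auto simp: incseq_def le_fun_def intro!: point_sum_mono)
    from LIMSEQ_SUP[OF this] show ?thesis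
      by (simp add: sup flip: point_sum_SUP[OF inc])
  qed
  have "(\<lambda>i. expectation (\<lambda>\<omega>. exp_minus (point_sum X (f i) \<omega>))) \<longlonglongrightarrow>
      expectation (\<lambda>\<omega>. exp_minus (point_sum X g \<omega>))"
    using meas meas_g
    by (intro integral_dominated_convergence[where w = "\<lambda>_. 1"]) (auto intro!: tendsto_exp_minus lim)
  moreover have "(\<lambda>i. \<integral>\<^sup>+x. ennreal (1 - exp_minus (f i x)) \<partial>\<Lambda>) \<longlonglongrightarrow>
      (\<integral>\<^sup>+x. ennreal (1 - exp_minus (g x)) \<partial>\<Lambda>)"
  proof (rule nn_integral_LIMSEQ)
    have "exp_minus (f j x) \<le> exp_minus (f i x)" if "i \<le> j" for i j x
      using inc that f_top by (intro exp_minus_antimono) (auto simp: incseq_def le_fun_def)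
    then show "incseq (\<lambda>i x. ennreal (1 - exp_minus (f i x)))"
      by (auto simp: incseq_def le_fun_def intro!: ennreal_leI)
    show "(\<lambda>x. ennreal (1 - exp_minus (f i x))) \<in> borel_measurable \<Lambda>" for i
      using borel_measurable_simple_function[OF f] by measurable
    have "(\<lambda>i. f i x) \<longlonglongrightarrow> g x" for x
      unfolding sup[symmetric] using inc by (intro LIMSEQ_SUP) (auto simp: incseq_def le_fun_def)
    then show "(\<lambda>i. ennreal (1 - exp_minus (f i x))) \<longlonglongrightarrow> ennreal (1 - exp_minus (g x))" for x
      by (intro tendsto_intros tendsto_exp_minus)
  qed
  then have "(\<lambda>i. expectation (\<lambda>\<omega>. exp_minus (point_sum X (f i) \<omega>))) \<longlonglongrightarrow>
      exp_minus (\<integral>\<^sup>+x. ennreal (1 - exp_minus (g x)) \<partial>\<Lambda>)"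
    unfolding eq by (rule tendsto_exp_minus)
  ultimately show "expectation (\<lambda>\<omega>. exp_minus (point_sum X g \<omega>)) =
      exp_minus (\<integral>\<^sup>+x. ennreal (1 - exp_minus (g x)) \<partial>\<Lambda>)"
    by (rule LIMSEQ_unique)
qed

section \<open>Integrals\<close>

lemma nn_integral_exp_Ioi:
  assumes "b > 0"
  shows "(\<integral>\<^sup>+s\<in>{0<..}. ennreal (exp (- s * b)) \<partial>lborel) = ennreal (1 / b)"
proof -
  have "(\<integral>\<^sup>+s\<in>{0<..}. ennreal (exp (- s * b)) \<partial>lborel) = (\<integral>\<^sup>+s\<in>{0..}. ennreal (exp (- s * b)) \<partial>lborel)"
    using AE_lborel_singleton[of "0::real"]
    by (intro nn_integral_cong_AE) (auto simp: indicator_def elim!: eventually_mono)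
  also have "\<dots> = ennreal (0 - (- exp (- 0 * b) / b))"
  proof (rule nn_integral_FTC_atLeast)
    show "((\<lambda>s. - exp (- s * b) / b) \<longlongrightarrow> 0) at_top"
      using assms by real_asymp
  qed (use assms in \<open>auto intro!: derivative_eq_intros\<close>)
  finally show ?thesis
    by simp
qed

text \<open>Write \<open>(1 - exp (- s * S)) / s\<close> as the integral of
  \<open>exp (- s * u)\<close> over \<open>u\<close> in \<open>{0..S}\<close> and exchange the
  order: the inner integral over \<open>s\<close> becomes \<open>1 / (a + u)\<close>, whose
  primitive is the logarithm.\<close>

lemma ln_one_plus_eq_nn_integral:
  assumes a: "a > 0" and S: "S \<ge> 0"
  shows "ennreal (ln (1 + S / a)) =
    (\<integral>\<^sup>+s\<in>{0<..}. ennreal (exp (- s * a) / s * (1 - exp (- s * S))) \<partial>lborel)"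
proof -
  have "(\<integral>\<^sup>+s\<in>{0<..}. ennreal (exp (- s * a) / s * (1 - exp (- s * S))) \<partial>lborel) =
      (\<integral>\<^sup>+s. (\<integral>\<^sup>+u. ennreal (exp (- s * (a + u))) * indicator {0..S} u * indicator {0<..} s \<partial>lborel) \<partial>lborel)"
  proof (rule nn_integral_cong)
    fix s :: real
    have "(\<integral>\<^sup>+u\<in>{0..S}. ennreal (exp (- s * (a + u))) \<partial>lborel) =
        ennreal (- exp (- s * (a + S)) / s - (- exp (- s * (a + 0)) / s))" if "s > 0"
      using that S by (intro nn_integral_FTC_Icc) (auto intro!: derivative_eq_intros)
    moreover have "- exp (- s * (a + S)) / s - (- exp (- s * (a + 0)) / s) =
        exp (- s * a) / s * (1 - exp (- s * S))"
    proof -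
      have "exp (- s * (a + S)) = exp (- s * a) * exp (- s * S)"
        by (simp add: distrib_left flip: exp_add)
      then show ?thesis
        by (simp only:) (simp add: right_diff_distrib diff_divide_distrib)
    qed
    ultimately show "ennreal (exp (- s * a) / s * (1 - exp (- s * S))) * indicator {0<..} s =
        (\<integral>\<^sup>+u. ennreal (exp (- s * (a + u))) * indicator {0..S} u * indicator {0<..} s \<partial>lborel)"
      by (auto simp: indicator_def)
  qed
  also have "\<dots> = (\<integral>\<^sup>+u. (\<integral>\<^sup>+s. ennreal (exp (- s * (a + u))) * indicator {0..S} u * indicator {0<..} s \<partial>lborel) \<partial>lborel)"
    by (rule lborel_pair.Fubini') measurable
  also have "\<dots> = (\<integral>\<^sup>+u. ennreal (1 / (a + u)) * indicator {0..S} u \<partial>lborel)"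
  proof (rule nn_integral_cong)
    fix u :: real
    show "(\<integral>\<^sup>+s. ennreal (exp (- s * (a + u))) * indicator {0..S} u * indicator {0<..} s \<partial>lborel) =
        ennreal (1 / (a + u)) * indicator {0..S} u"
      using nn_integral_exp_Ioi[of "a + u"] a by (auto simp: indicator_def)
  qed
  also have "\<dots> = ennreal (ln (a + S) - ln (a + 0))"
    using a S by (intro nn_integral_FTC_Icc) (auto intro!: derivative_eq_intros)
  also have "ln (a + S) - ln (a + 0) = ln (1 + S / a)"
    using a S ln_div[of "a + S" a] by (simp add: add_divide_distrib)
  finally show ?thesis ..
qed

section \<open>The Laplace transform of the gamma law\<close>

lemma gamma_density_nonneg: "k > 0 \<Longrightarrow> 0 \<le> gamma_density k \<theta> x"
  by (auto simp: gamma_density_def intro!: divide_nonneg_nonneg mult_nonneg_nonneg Gamma_real_nonneg less_imp_le)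

text \<open>The substitution \<open>t = b * x\<close> in Euler's integral for \<open>Gamma n\<close>
  turns its integrand into a constant multiple of the tilted gamma density.\<close>

lemma gamma_laplace:
  assumes n: "n > 0" and c: "c \<ge> 0"
  shows "(\<integral>\<^sup>+x. ennreal (gamma_density n (1 / n) x) * ennreal (exp (- max 0 (c * x))) \<partial>lborel) =
    ennreal (1 / (1 + c / n) powr n)"
proof -
  \<comment> \<open>The total exponential rate: \<open>n\<close> from the density with scale
    \<open>1 / n\<close>, and \<open>c\<close> from the transform.\<close>
  define b where "b = n + c"
  have b: "b > 0" using n c by (simp add: b_def)
  have G: "Gamma n > 0" using n by (rule Gamma_real_pos)
  have "ennreal (Gamma n) = (\<integral>\<^sup>+t. ennreal (indicator {0..} t * t powr (n - 1) / exp t) \<partial>lborel)"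
    by (rule Gamma_conv_nn_integral_real[OF n])
  also have "\<dots> = ennreal b * (\<integral>\<^sup>+x. ennreal (indicator {0..} (b * x) * (b * x) powr (n - 1) / exp (b * x)) \<partial>lborel)"
    using nn_integral_real_affine[of "\<lambda>t. ennreal (indicator {0..} t * t powr (n - 1) / exp t)" b 0] b
    by simp
  also have "\<dots> = (\<integral>\<^sup>+x. ennreal (Gamma n * (1 + c / n) powr n) *
      (ennreal (gamma_density n (1 / n) x) * ennreal (exp (- max 0 (c * x)))) \<partial>lborel)"
  proof (subst nn_integral_cmult[symmetric], simp, rule nn_integral_cong_AE,
      use AE_lborel_singleton[of "0::real"] in eventually_elim)
    fix x :: real assume x: "x \<noteq> 0"
    show "ennreal b * ennreal (indicator {0..} (b * x) * (b * x) powr (n - 1) / exp (b * x)) =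
        ennreal (Gamma n * (1 + c / n) powr n) *
          (ennreal (gamma_density n (1 / n) x) * ennreal (exp (- max 0 (c * x))))"
    proof (cases "x > 0")
      case True
      have *: "(1 + c / n) powr n = b powr n / n powr n"
        using n c b by (subst powr_divide[symmetric]) (auto simp: b_def field_simps)
      have "(b * x) powr (n - 1) = b powr n / b * x powr (n - 1)"
        using b True by (simp add: powr_mult powr_diff)
      moreover have "1 / exp (b * x) = exp (- x / (1 / n)) * exp (- max 0 (c * x))"
      proof -
        have "- x / (1 / n) + - max 0 (c * x) = - (b * x)"
          using n c True by (simp add: b_def max_def algebra_simps)
        then show ?thesis
          by (simp only: exp_minus[of "b * x"] inverse_eq_divide flip: exp_add)
      qed
      moreover have "(1 / n) powr n = 1 / n powr n"
        using n by (simp add: powr_divide)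
      ultimately have "b * ((b * x) powr (n - 1) / exp (b * x)) =
          Gamma n * (1 + c / n) powr n * (gamma_density n (1 / n) x * exp (- max 0 (c * x)))"
        using n b True G unfolding * by (simp add: gamma_density_def field_simps less_imp_neq[THEN not_sym])
      then show ?thesis
        using n c b True G by (simp add: gamma_density_nonneg zero_le_mult_iff flip: ennreal_mult)
    next
      case False
      then show ?thesis
        using x b by (simp add: gamma_density_def indicator_def zero_le_mult_iff)
    qed
  qed
  also have "\<dots> = ennreal (Gamma n * (1 + c / n) powr n) *
      (\<integral>\<^sup>+x. ennreal (gamma_density n (1 / n) x) * ennreal (exp (- max 0 (c * x))) \<partial>lborel)"
    unfolding gamma_density_def by (rule nn_integral_cmult) measurable
  finally have eq: "ennreal (Gamma n) = ennreal (Gamma n * (1 + c / n) powr n) *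
      (\<integral>\<^sup>+x. ennreal (gamma_density n (1 / n) x) * ennreal (exp (- max 0 (c * x))) \<partial>lborel)" .
  have p: "(1 + c / n) powr n > 0"
    using n c by (smt (verit) divide_nonneg_pos powr_gt_zero)
  have "ennreal (1 / (1 + c / n) powr n) = ennreal (1 / (Gamma n * (1 + c / n) powr n)) * ennreal (Gamma n)"
    using G p by (simp flip: ennreal_mult)
  also have "\<dots> = (\<integral>\<^sup>+x. ennreal (gamma_density n (1 / n) x) * ennreal (exp (- max 0 (c * x))) \<partial>lborel)"
    unfolding eq using G p by (simp add: mult.assoc[symmetric] flip: ennreal_mult)
  finally show ?thesis ..
qed

text \<open>Both measures give \<open>{..r}\<close> the area of the disc of radius \<open>r\<close>,
  and these half-lines form an intersection-stable generator of the Borel sets. This is polar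
  integration for radial functions.\<close>

lemma distr_norm_lborel_plane:
  "distr (lborel :: (real ^ 2) measure) borel norm =
   density lborel (\<lambda>x. ennreal (2 * pi * x) * indicator {0<..} x)"
proof (rule measure_eqI_generator_eq[where E = "range atMost" and \<Omega> = UNIV and A = "\<lambda>n. {.. real n}"])
  show "Int_stable (range atMost :: real set set)"
    by (auto simp: Int_stable_def intro!: image_eqI[OF _ UNIV_I])
  show "sets (distr (lborel :: (real ^ 2) measure) borel norm) = sigma_sets UNIV (range atMost)"
    by (simp add: borel_eq_atMost)
  show "sets (density lborel (\<lambda>x. ennreal (2 * pi * x) * indicator {0<..} x)) = sigma_sets UNIV (range (atMost :: real \<Rightarrow> _))"
    by (simp add: borel_eq_atMost)
  have ball: "emeasure (distr (lborel :: (real ^ 2) measure) borel norm) {..r} = ennreal (if r \<ge> 0 then pi * r\<^sup>2 else 0)" for r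
  proof -
    have "norm -` {..r} = cball (0 :: real ^ 2) r"
      by auto
    then show ?thesis
      by (cases "r \<ge> 0") (auto simp: emeasure_distr emeasure_cball unit_ball_vol_2 eval_unit_ball_vol)
  qed
  fix A :: "real set" assume "A \<in> range atMost"
  then obtain r where A: "A = {..r}" by auto
  have "emeasure (density lborel (\<lambda>x. ennreal (2 * pi * x) * indicator {0<..} x)) {..r} =
      (\<integral>\<^sup>+x. ennreal (2 * pi * x) * indicator {0..r} x \<partial>lborel)"
    by (auto simp: emeasure_density indicator_def intro!: nn_integral_cong)
  also have "\<dots> = ennreal (if r \<ge> 0 then pi * r\<^sup>2 else 0)"
  proof (cases "r \<ge> 0")
    case True
    have "(\<integral>\<^sup>+x. ennreal (2 * pi * x) * indicator {0..r} x \<partial>lborel) = ennreal (pi * r\<^sup>2 - pi * 0\<^sup>2)"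
      using True by (intro nn_integral_FTC_Icc) (auto intro!: derivative_eq_intros)
    then show ?thesis using True by simp
  qed (simp add: indicator_def)
  finally show "emeasure (distr (lborel :: (real ^ 2) measure) borel norm) A =
      emeasure (density lborel (\<lambda>x. ennreal (2 * pi * x) * indicator {0<..} x)) A"
    by (simp add: A ball)
next
  fix n :: nat
  have "norm -` {..real n} = cball (0 :: real ^ 2) (real n)"
    by auto
  then show "emeasure (distr (lborel :: (real ^ 2) measure) borel norm) {..real n} \<noteq> \<infinity>"
    by (auto simp: emeasure_distr emeasure_cball)
  show "(\<Union>n. {.. real n}) = UNIV"
    by (auto simp: real_arch_simple)
qed auto

lemma nn_integral_polar_plane:
  assumes [measurable]: "f \<in> borel_measurable borel"
  shows "(\<integral>\<^sup>+x. f (norm (x :: real ^ 2)) \<partial>lborel) =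
    (\<integral>\<^sup>+x\<in>{0<..}. ennreal (2 * pi * x) * f x \<partial>lborel)"
proof -
  have "(\<integral>\<^sup>+x. f (norm (x :: real ^ 2)) \<partial>lborel) = (\<integral>\<^sup>+x. f x \<partial>distr (lborel :: (real ^ 2) measure) borel norm)"
    by (subst nn_integral_distr) auto
  also have "\<dots> = (\<integral>\<^sup>+x\<in>{0<..}. ennreal (2 * pi * x) * f x \<partial>lborel)"
    unfolding distr_norm_lborel_plane by (subst nn_integral_density) (auto simp: mult_ac)
  finally show ?thesis .
qed

section \<open>Independence of the sources\<close>

context virtual_cell_network
begin

definition sources :: "source set" where
  "sources = {i. \<forall>k. i = Serving_Fading k \<longrightarrow> k \<in> {1..K}}"

text \<open>Generalizes \<open>other_sources\<close> to arbitrary groups of sources, since different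
  steps of the argument need different groupings.\<close>

definition source_algebra :: "source set \<Rightarrow> 'w measure" where
  "source_algebra I = sigma (space P) (\<Union>i\<in>I. source_events P K AP X h G H i)"

lemma space_source_algebra [simp]: "space (source_algebra I) = space P"
  by (simp add: source_algebra_def space_measure_of_conv)

lemma sets_source_algebra:
  "sets (source_algebra I) = sigma_sets (space P) (\<Union>i\<in>I. source_events P K AP X h G H i)"
  using source_events_subset unfolding source_algebra_def by (subst sets_measure_of) auto

lemma source_event_in_source_algebra:
  "E \<in> source_events P K AP X h G H i \<Longrightarrow> i \<in> I \<Longrightarrow> E \<in> sets (source_algebra I)"
  unfolding sets_source_algebra by auto

lemma source_algebra_subset_events:
  assumes "I \<subseteq> sources"
  shows "sets (source_algebra I) \<subseteq> events"
  unfolding sets_source_algebra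
proof (rule sets.sigma_sets_subset)
  show "(\<Union>i\<in>I. source_events P K AP X h G H i) \<subseteq> events"
    using independent assms unfolding indep_sets_def sources_def by blast
qed

lemma measurable_source_algebra_P:
  assumes "f \<in> measurable (source_algebra I) N'" "I \<subseteq> sources"
  shows "f \<in> measurable P N'"
  using assms source_algebra_subset_events[OF assms(2)]
  unfolding measurable_def by (auto dest: subsetD)

lemma measurable_source_algebra_mono:
  assumes "f \<in> measurable (source_algebra I) N'" "I \<subseteq> J"
  shows "f \<in> measurable (source_algebra J) N'"
proof -
  have "sets (source_algebra I) \<subseteq> sets (source_algebra J)"
    unfolding sets_source_algebra using assms(2) by (intro sigma_sets_mono') auto
  then show ?thesis
    using assms(1) unfolding measurable_def by (auto dest: subsetD)
qed

lemma rv_measurable_source_algebra: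
  fixes Y :: "'w \<Rightarrow> real"
  assumes "rv_events P borel Y = source_events P K AP X h G H i" "i \<in> I"
  shows "Y \<in> borel_measurable (source_algebra I)"
proof (rule measurableI)
  fix A :: "real set" assume "A \<in> sets borel"
  then have "Y -` A \<inter> space P \<in> rv_events P borel Y"
    by (auto simp: rv_events_def)
  then show "Y -` A \<inter> space (source_algebra I) \<in> sets (source_algebra I)"
    using source_event_in_source_algebra assms by auto
qed auto

lemma G_measurable: "Gain t l \<in> I \<Longrightarrow> G t l \<in> borel_measurable (source_algebra I)"
  and H_measurable: "Fading t l \<in> I \<Longrightarrow> H t l \<in> borel_measurable (source_algebra I)"
  and h_measurable: "Serving_Fading k \<in> I \<Longrightarrow> h k \<in> borel_measurable (source_algebra I)"
  by (simp_all add: rv_measurable_source_algebra[where i = "Gain t l"]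
      rv_measurable_source_algebra[where i = "Fading t l"]
      rv_measurable_source_algebra[where i = "Serving_Fading k"])

text \<open>Each family of source events is closed under intersection (for \<open>Points\<close> it
  is already a sigma-algebra), so independence passes to the sigma-algebras generated by disjoint
  groups.\<close>

lemma indep_source_algebras:
  assumes "disjoint_family_on I J" "(\<Union>j\<in>J. I j) \<subseteq> sources"
  shows "indep_sets (\<lambda>j. sets (source_algebra (I j))) J"
  unfolding sets_source_algebra
proof (rule indep_sets_collect_sigma)
  show "indep_sets (source_events P K AP X h G H) (\<Union>j\<in>J. I j)"
    using independent assms(2) unfolding sources_def by (rule indep_sets_mono_index[rotated])
  show "Int_stable (source_events P K AP X h G H i)" for i
  proof (cases i)
    case (Points t)
    have "source_events P K AP X h G H i =
        sets (sigma (space P) {point_event P (X t) l A | l A. A \<in> sets borel})"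
      unfolding Points by (subst sets_measure_of) (auto simp: point_event_def)
    then show ?thesis
      by (simp add: sets.Int_stable)
  qed (auto simp: Int_stable_rv_events)
qed (fact assms(1))

lemma indep_vars_source_algebras:
  assumes "disjoint_family_on I J" "(\<Union>j\<in>J. I j) \<subseteq> sources"
    and Y: "\<And>j. j \<in> J \<Longrightarrow> Y j \<in> measurable (source_algebra (I j)) (N' j)"
  shows "indep_vars N' Y J"
  unfolding indep_vars_def2
proof (intro conjI ballI)
  show "indep_sets (\<lambda>j. {Y j -` A \<inter> space P | A. A \<in> sets (N' j)}) J"
    by (rule indep_sets_mono_sets[OF indep_source_algebras[OF assms(1,2)]])
      (use measurable_sets[OF Y] in auto)
  show "random_variable (N' j) (Y j)" if "j \<in> J" for j
    using measurable_source_algebra_P[OF Y[OF that]] assms(2) that by auto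
qed

text \<open>The outcome itself, observed through \<open>source_algebra A\<close>, is taken as the
  random element independent of \<open>Z\<close>. The joint law is then a product, and Fubini
  freezes everything that depends on \<open>A\<close> without listing it.\<close>

lemma nn_integral_indep_source:
  assumes AB: "A \<inter> B = {}" "A \<union> B \<subseteq> sources"
    and Z: "Z \<in> measurable (source_algebra B) N'"
    and f: "f \<in> borel_measurable (source_algebra A \<Otimes>\<^sub>M N')"
  shows "(\<integral>\<^sup>+\<omega>. f (\<omega>, Z \<omega>) \<partial>P) = (\<integral>\<^sup>+\<omega>. (\<integral>\<^sup>+\<omega>'. f (\<omega>, Z \<omega>') \<partial>P) \<partial>P)"
proof -
  note [measurable] = f
  have id [measurable]: "(\<lambda>\<omega>. \<omega>) \<in> measurable P (source_algebra A)"
    by (rule measurable_source_algebra_P[of _ A]) (use AB in auto)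
  have Zm [measurable]: "Z \<in> measurable P N'"
    by (rule measurable_source_algebra_P[OF Z]) (use AB in auto)
  let ?D = "distr P (source_algebra A) (\<lambda>\<omega>. \<omega>)"
  let ?Z = "distr P N' Z"
  interpret Z: prob_space ?Z
    by (rule prob_space_distr) measurable
  interpret D: prob_space ?D
    by (rule prob_space_distr) measurable
  have ind: "indep_set (sets (source_algebra A)) (sets (source_algebra B))"
  proof -
    have "indep_sets (\<lambda>j. sets (source_algebra (case_bool A B j))) UNIV"
      by (rule indep_source_algebras)
        (use AB in \<open>auto simp: disjoint_family_on_def split: bool.splits\<close>)
    then show ?thesis
      unfolding indep_set_def by (rule indep_sets_mono_sets) (auto split: bool.splits)
  qed
  have eq: "?D \<Otimes>\<^sub>M ?Z = distr P (source_algebra A \<Otimes>\<^sub>M N') (\<lambda>\<omega>. (\<omega>, Z \<omega>))"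
  proof (rule pair_measure_eqI)
    fix E F assume "E \<in> sets ?D" "F \<in> sets ?Z"
    then have [measurable]: "E \<in> sets (source_algebra A)" "F \<in> sets N'"
      by auto
    have E: "E \<inter> space P = E"
      using sets.sets_into_space[of E "source_algebra A"] by auto
    have "prob (E \<inter> (Z -` F \<inter> space P)) = prob E * prob (Z -` F \<inter> space P)"
      using measurable_sets[OF Z \<open>F \<in> sets N'\<close>] by (intro indep_setD[OF ind]) auto
    moreover have "(\<lambda>\<omega>. (\<omega>, Z \<omega>)) -` (E \<times> F) \<inter> space P = E \<inter> (Z -` F \<inter> space P)"
      using E by auto
    ultimately show "emeasure ?D E * emeasure ?Z F =
        emeasure (distr P (source_algebra A \<Otimes>\<^sub>M N') (\<lambda>\<omega>. (\<omega>, Z \<omega>))) (E \<times> F)"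
      by (simp add: emeasure_distr E emeasure_eq_measure ennreal_mult[symmetric])
  qed (auto intro: D.sigma_finite_measure_axioms Z.sigma_finite_measure_axioms
         cong: sets_pair_measure_cong)
  have "(\<integral>\<^sup>+\<omega>. f (\<omega>, Z \<omega>) \<partial>P) = (\<integral>\<^sup>+z. f z \<partial>(?D \<Otimes>\<^sub>M ?Z))"
    unfolding eq by (subst nn_integral_distr) auto
  also have "\<dots> = (\<integral>\<^sup>+\<omega>. (\<integral>\<^sup>+z. f (\<omega>, z) \<partial>?Z) \<partial>?D)"
    by (rule Z.nn_integral_fst[symmetric]) simp
  also have "\<dots> = (\<integral>\<^sup>+\<omega>. (\<integral>\<^sup>+z. f (\<omega>, z) \<partial>?Z) \<partial>P)"
    by (rule nn_integral_distr) (auto intro!: Z.borel_measurable_nn_integral)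
  also have "\<dots> = (\<integral>\<^sup>+\<omega>. (\<integral>\<^sup>+\<omega>'. f (\<omega>, Z \<omega>') \<partial>P) \<partial>P)"
  proof (rule nn_integral_cong)
    fix \<omega> assume "\<omega> \<in> space P"
    then have [measurable]: "\<omega> \<in> space (source_algebra A)"
      by simp
    show "(\<integral>\<^sup>+z. f (\<omega>, z) \<partial>?Z) = (\<integral>\<^sup>+\<omega>'. f (\<omega>, Z \<omega>') \<partial>P)"
      by (rule nn_integral_distr) auto
  qed
  finally show ?thesis .
qed

section \<open>Integrating out the marks\<close>

text \<open>The origin stands in for the location of an absent point.\<close>

definition location :: "link \<Rightarrow> nat \<Rightarrow> 'w \<Rightarrow> real ^ 2" where
  "location t l \<omega> = (case X t l \<omega> of None \<Rightarrow> 0 | Some x \<Rightarrow> x)"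

text \<open>Replaces a case distinction on \<open>option\<close> values by a vector-valued map and a
  predicate, both of which are measurable.\<close>

lemma case_X_eq: "(case X t l \<omega> of None \<Rightarrow> c | Some x \<Rightarrow> f x) =
    (if X t l \<omega> \<noteq> None then f (location t l \<omega>) else c)"
  by (auto simp: location_def split: option.splits)

lemma point_event_in_source_algebra:
  assumes "A \<in> sets borel" "Points t \<in> I"
  shows "point_event P (X t) l A \<in> sets (source_algebra I)"
  by (rule source_event_in_source_algebra[where i = "Points t"]) (use assms in auto)

lemma location_measurable:
  assumes "Points t \<in> I"
  shows "location t l \<in> borel_measurable (source_algebra I)"
proof (rule measurableI)
  note pe = point_event_in_source_algebra[OF _ assms]
  fix A :: "(real ^ 2) set" assume A: "A \<in> sets borel"
  \<comment> \<open>When \<open>A\<close> contains the origin, the preimage also picks up the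
    outcomes in which label \<open>l\<close> is absent.\<close>
  have "location t l -` A \<inter> space (source_algebra I) =
      (if 0 \<in> A then point_event P (X t) l A \<union> (space (source_algebra I) - point_event P (X t) l UNIV)
       else point_event P (X t) l A)"
    by (auto simp: location_def point_event_def split: option.splits)
  then show "location t l -` A \<inter> space (source_algebra I) \<in> sets (source_algebra I)"
    using sets.Un[OF pe[OF A, of l] sets.compl_sets[OF pe[of UNIV l]]] pe[OF A, of l] by simp
qed auto

lemma present_measurable:
  assumes "Points t \<in> I"
  shows "Measurable.pred (source_algebra I) (\<lambda>\<omega>. X t l \<omega> \<noteq> None)"
proof -
  have "{\<omega> \<in> space (source_algebra I). X t l \<omega> \<noteq> None} = point_event P (X t) l UNIV"
    by (auto simp: point_event_def)
  then show ?thesis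
    using point_event_in_source_algebra[OF _ assms, of UNIV l] by (simp add: pred_def)
qed

lemma case_X_measurable:
  assumes I: "Points t \<in> I" and f: "f \<in> borel_measurable borel"
  shows "(\<lambda>\<omega>. case X t l \<omega> of None \<Rightarrow> c | Some x \<Rightarrow> f x) \<in> borel_measurable (source_algebra I)"
proof -
  note [measurable] = location_measurable[OF I] present_measurable[OF I] f
  show ?thesis
    unfolding case_X_eq by measurable
qed

text \<open>The factor \<open>V\<close> makes the induction on \<open>n\<close> work: it absorbs the points whose marks
  are already integrated out.\<close>

lemma nn_integral_marks:
  fixes u :: "real ^ 2 \<Rightarrow> real \<Rightarrow> ennreal"
  assumes u: "case_prod u \<in> borel_measurable (borel \<Otimes>\<^sub>M borel)"
    and \<phi>: "\<phi> \<in> borel_measurable borel" "\<And>l x. (\<integral>\<^sup>+\<omega>. u x (G t l \<omega> * H t l \<omega>) \<partial>P) = \<phi> x"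
    and V: "V \<in> borel_measurable (source_algebra {Points t})"
  shows "(\<integral>\<^sup>+\<omega>. V \<omega> * (\<Prod>l<n. case X t l \<omega> of None \<Rightarrow> 1 | Some x \<Rightarrow> u x (G t l \<omega> * H t l \<omega>)) \<partial>P) =
    (\<integral>\<^sup>+\<omega>. V \<omega> * (\<Prod>l<n. case X t l \<omega> of None \<Rightarrow> 1 | Some x \<Rightarrow> \<phi> x) \<partial>P)"
  using V
proof (induction n arbitrary: V)
  case (Suc n)
  let ?U = "\<lambda>l \<omega>. case X t l \<omega> of None \<Rightarrow> 1 | Some x \<Rightarrow> u x (G t l \<omega> * H t l \<omega>)"
  let ?F = "\<lambda>l \<omega>. case X t l \<omega> of None \<Rightarrow> 1 | Some x \<Rightarrow> \<phi> x"
  \<comment> \<open>All locations and the marks of the earlier labels are frozen; only the two marks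
    of label \<open>n\<close>, collected in \<open>B\<close>, are averaged.\<close>
  define A where "A = insert (Points t) (Gain t ` {..<n} \<union> Fading t ` {..<n})"
  define B where "B = {Gain t n, Fading t n}"
  define Z where "Z \<omega> = G t n \<omega> * H t n \<omega>" for \<omega>
  define f where "f = (\<lambda>(\<omega>, z). V \<omega> * (\<Prod>l<n. ?U l \<omega>) * (case X t n \<omega> of None \<Rightarrow> 1 | Some x \<Rightarrow> u x z))"
  have AB: "A \<inter> B = {}" "A \<union> B \<subseteq> sources" "Points t \<in> A"
    by (auto simp: A_def B_def sources_def)
  have u': "(\<lambda>z. u (a z) (b z)) \<in> borel_measurable S"
    if "a \<in> borel_measurable S" "b \<in> borel_measurable S" for a b and S :: "'y measure"
    using measurable_compose[OF measurable_Pair[OF that] u] by simp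
  have Z: "Z \<in> borel_measurable (source_algebra B)"
    unfolding Z_def by (intro borel_measurable_times G_measurable H_measurable) (auto simp: B_def)
  have Vm [measurable]: "V \<in> borel_measurable (source_algebra A)"
    by (rule measurable_source_algebra_mono[OF Suc.prems]) (auto simp: A_def)
  have U [measurable]: "?U l \<in> borel_measurable (source_algebra A)" if "l < n" for l
  proof -
    have [measurable]: "G t l \<in> borel_measurable (source_algebra A)"
      "H t l \<in> borel_measurable (source_algebra A)"
      using that by (auto intro!: G_measurable H_measurable simp: A_def)
    note [measurable] = location_measurable[OF AB(3)] present_measurable[OF AB(3)]
    have "(\<lambda>\<omega>. u (location t l \<omega>) (G t l \<omega> * H t l \<omega>)) \<in> borel_measurable (source_algebra A)"
      by (rule u') measurable
    then show ?thesis
      unfolding case_X_eq by measurable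
  qed
  have f: "f \<in> borel_measurable (source_algebra A \<Otimes>\<^sub>M borel)"
  proof -
    note [measurable] = location_measurable[OF AB(3)] present_measurable[OF AB(3)]
    have [measurable]: "(\<lambda>\<omega>. \<Prod>l<n. ?U l \<omega>) \<in> borel_measurable (source_algebra A)"
      by (rule borel_measurable_prod_ennreal) (use U in auto)
    have [measurable]: "(\<lambda>z. u (location t n (fst z)) (snd z)) \<in> borel_measurable (source_algebra A \<Otimes>\<^sub>M borel)"
      by (rule u') measurable
    show ?thesis
      unfolding f_def split_beta case_X_eq[where l = n] by measurable
  qed
  have "(\<integral>\<^sup>+\<omega>. V \<omega> * (\<Prod>l<Suc n. ?U l \<omega>) \<partial>P) = (\<integral>\<^sup>+\<omega>. f (\<omega>, Z \<omega>) \<partial>P)"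
    by (intro nn_integral_cong) (simp add: f_def Z_def mult.assoc)
  also have "\<dots> = (\<integral>\<^sup>+\<omega>. (\<integral>\<^sup>+\<omega>'. f (\<omega>, Z \<omega>') \<partial>P) \<partial>P)"
    by (rule nn_integral_indep_source[OF AB(1,2) Z f])
  also have "\<dots> = (\<integral>\<^sup>+\<omega>. V \<omega> * ?F n \<omega> * (\<Prod>l<n. ?U l \<omega>) \<partial>P)"
  proof (rule nn_integral_cong)
    fix \<omega>
    have [measurable]: "Z \<in> borel_measurable P"
      by (rule measurable_source_algebra_P[OF Z]) (use AB in auto)
    have [measurable]: "(\<lambda>\<omega>'. u x (Z \<omega>')) \<in> borel_measurable P" for x
      by (rule u') measurable
    have "(\<integral>\<^sup>+\<omega>'. f (\<omega>, Z \<omega>') \<partial>P) =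
        V \<omega> * (\<Prod>l<n. ?U l \<omega>) * (\<integral>\<^sup>+\<omega>'. (case X t n \<omega> of None \<Rightarrow> 1 | Some x \<Rightarrow> u x (Z \<omega>')) \<partial>P)"
      unfolding f_def by (cases "X t n \<omega>") (simp_all add: nn_integral_cmult)
    also have "(\<integral>\<^sup>+\<omega>'. (case X t n \<omega> of None \<Rightarrow> 1 | Some x \<Rightarrow> u x (Z \<omega>')) \<partial>P) = ?F n \<omega>"
      using \<phi>(2)[of _ n] by (auto simp: Z_def emeasure_space_1 split: option.split)
    finally show "(\<integral>\<^sup>+\<omega>'. f (\<omega>, Z \<omega>') \<partial>P) = V \<omega> * ?F n \<omega> * (\<Prod>l<n. ?U l \<omega>)"
      by (simp add: mult_ac)
  qed
  \<comment> \<open>The averaged factor depends on the points alone, so it may join \<open>V\<close>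
    in the induction hypothesis.\<close>
  also have "\<dots> = (\<integral>\<^sup>+\<omega>. V \<omega> * ?F n \<omega> * (\<Prod>l<n. ?F l \<omega>) \<partial>P)"
    by (rule Suc.IH) (intro borel_measurable_times_ennreal Suc.prems case_X_measurable \<phi>, simp)
  finally show ?case
    by (simp add: mult_ac)
qed simp

section \<open>The Laplace functional of a marked Poisson process\<close>

abbreviation link_intensity :: "link \<Rightarrow> (real ^ 2) measure" where
  "link_intensity t \<equiv> density lborel (\<lambda>x. ennreal (lam * link_prob \<beta> t (norm x)))"

lemma link_prob_measurable [measurable]: "link_prob \<beta> t \<in> borel_measurable borel"
proof (cases t)
  case LOS
  then have "link_prob \<beta> t = (\<lambda>r. exp (- \<beta> * r))"
    by auto
  then show ?thesis
    by simp
next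
  case NLOS
  then have "link_prob \<beta> t = (\<lambda>r. 1 - exp (- \<beta> * r))"
    by auto
  then show ?thesis
    by simp
qed

text \<open>Averaging the marks of a point at \<open>x\<close> leaves the factor
  \<open>\<phi> x\<close>, so the marked sum has the same transform as the unmarked point sum of
  \<open>- ln (\<phi> x)\<close>. The bounds on \<phi> make this weight finite and
  nonnegative.\<close>

lemma marked_laplace:
  fixes w :: "real ^ 2 \<Rightarrow> real \<Rightarrow> ennreal" and \<phi> :: "real ^ 2 \<Rightarrow> real"
  assumes w: "case_prod w \<in> borel_measurable (borel \<Otimes>\<^sub>M borel)"
    and \<phi> [measurable]: "\<phi> \<in> borel_measurable borel"
    and \<phi>_pos: "\<And>x. 0 < \<phi> x" and \<phi>_le: "\<And>x. \<phi> x \<le> 1"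
    and \<phi>_eq: "\<And>l x. (\<integral>\<^sup>+\<omega>. ennreal (exp_minus (w x (G t l \<omega> * H t l \<omega>))) \<partial>P) = ennreal (\<phi> x)"
  shows "(\<lambda>\<omega>. \<Sum>l. case X t l \<omega> of None \<Rightarrow> 0 | Some x \<Rightarrow> w x (G t l \<omega> * H t l \<omega>))
      \<in> borel_measurable (source_algebra ({Points t} \<union> range (Gain t) \<union> range (Fading t)))" (is "?S \<in> _")
    and "expectation (\<lambda>\<omega>. exp_minus (\<Sum>l. case X t l \<omega> of None \<Rightarrow> 0 | Some x \<Rightarrow> w x (G t l \<omega> * H t l \<omega>))) =
      exp_minus (\<integral>\<^sup>+x. ennreal (1 - \<phi> x) \<partial>link_intensity t)"
proof -
  let ?A = "{Points t} \<union> range (Gain t) \<union> range (Fading t)"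
  let ?a = "\<lambda>l \<omega>. case X t l \<omega> of None \<Rightarrow> 0 | Some x \<Rightarrow> w x (G t l \<omega> * H t l \<omega>)"
  define g where "g x = ennreal (- ln (\<phi> x))" for x
  let ?b = "\<lambda>l \<omega>. case X t l \<omega> of None \<Rightarrow> 0 | Some x \<Rightarrow> g x"
  have A: "Points t \<in> ?A" "?A \<subseteq> sources"
    by (auto simp: sources_def)
  have a: "?a l \<in> borel_measurable (source_algebra ?A)" for l
  proof -
    note [measurable] = location_measurable[OF A(1)] present_measurable[OF A(1)]
    have [measurable]: "G t l \<in> borel_measurable (source_algebra ?A)"
      "H t l \<in> borel_measurable (source_algebra ?A)"
      by (auto intro!: G_measurable H_measurable)
    have "(\<lambda>\<omega>. (location t l \<omega>, G t l \<omega> * H t l \<omega>)) \<in> source_algebra ?A \<rightarrow>\<^sub>M borel \<Otimes>\<^sub>M borel"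
      by measurable
    from measurable_compose[OF this w]
    have [measurable]: "(\<lambda>\<omega>. w (location t l \<omega>) (G t l \<omega> * H t l \<omega>)) \<in> borel_measurable (source_algebra ?A)"
      by simp
    show ?thesis
      unfolding case_X_eq by measurable
  qed
  then show S: "?S \<in> borel_measurable (source_algebra ?A)"
    by (rule borel_measurable_suminf_order)
  have [measurable]: "?a l \<in> borel_measurable P" for l
    by (rule measurable_source_algebra_P[OF a A(2)])
  have [measurable]: "?S \<in> borel_measurable P"
    by (rule measurable_source_algebra_P[OF S A(2)])
  have [measurable]: "g \<in> borel_measurable borel"
    unfolding g_def by measurable
  have b [measurable]: "?b l \<in> borel_measurable P" for l
    by (rule measurable_source_algebra_P[OF case_X_measurable A(2)]) (use A in auto)
  have g: "exp_minus (g x) = \<phi> x" for x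
    using \<phi>_pos[of x] \<phi>_le[of x] by (simp add: g_def exp_minus_ennreal max_def)
  \<comment> \<open>Finite partial sums come first, because \<open>nn_integral_marks\<close> handles
    finitely many labels; it is used here with \<open>V\<close> equal to 1.\<close>
  have eq: "expectation (\<lambda>\<omega>. exp_minus (\<Sum>l<n. ?a l \<omega>)) = expectation (\<lambda>\<omega>. exp_minus (\<Sum>l<n. ?b l \<omega>))" for n
  proof -
    define u where "u x z = ennreal (exp_minus (w x z))" for x z
    have prod_a: "ennreal (exp_minus (\<Sum>l<n. ?a l \<omega>)) =
        1 * (\<Prod>l<n. case X t l \<omega> of None \<Rightarrow> 1 | Some x \<Rightarrow> u x (G t l \<omega> * H t l \<omega>))" for \<omega>
      unfolding exp_minus_sum u_def
      by (subst prod_ennreal[symmetric]) (auto intro!: prod.cong split: option.split)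
    have prod_b: "ennreal (exp_minus (\<Sum>l<n. ?b l \<omega>)) =
        1 * (\<Prod>l<n. case X t l \<omega> of None \<Rightarrow> 1 | Some x \<Rightarrow> ennreal (\<phi> x))" for \<omega>
      unfolding exp_minus_sum
      by (subst prod_ennreal[symmetric]) (auto intro!: prod.cong simp: g split: option.split)
    have "case_prod u = (\<lambda>z. ennreal (exp_minus (case_prod w z)))"
      by (auto simp: u_def)
    then have "case_prod u \<in> borel_measurable (borel \<Otimes>\<^sub>M borel)"
      using w by simp
    then have "(\<integral>\<^sup>+\<omega>. ennreal (exp_minus (\<Sum>l<n. ?a l \<omega>)) \<partial>P) = (\<integral>\<^sup>+\<omega>. ennreal (exp_minus (\<Sum>l<n. ?b l \<omega>)) \<partial>P)"
      unfolding prod_a prod_b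
      by (rule nn_integral_marks) (simp_all add: u_def \<phi>_eq)
    then show ?thesis
      by (subst (1 2) integral_eq_nn_integral) simp_all
  qed
  \<comment> \<open>Both sequences of expectations coincide term by term, so their limits, the
    marked and the unmarked transform, agree.\<close>
  have "(\<lambda>n. expectation (\<lambda>\<omega>. exp_minus (\<Sum>l<n. ?a l \<omega>))) \<longlonglongrightarrow> expectation (\<lambda>\<omega>. exp_minus (?S \<omega>))"
    by (intro integral_dominated_convergence[where w = "\<lambda>_. 1"])
      (auto intro!: tendsto_exp_minus summable_LIMSEQ)
  moreover have "(\<lambda>n. expectation (\<lambda>\<omega>. exp_minus (\<Sum>l<n. ?b l \<omega>))) \<longlonglongrightarrow>
      expectation (\<lambda>\<omega>. exp_minus (point_sum (X t) g \<omega>))"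
    unfolding point_sum_def
    by (intro integral_dominated_convergence[where w = "\<lambda>_. 1"])
      (auto intro!: tendsto_exp_minus summable_LIMSEQ)
  moreover have "expectation (\<lambda>\<omega>. exp_minus (point_sum (X t) g \<omega>)) =
      exp_minus (\<integral>\<^sup>+x. ennreal (1 - exp_minus (g x)) \<partial>link_intensity t)"
  proof (rule poisson_laplace[OF X_poisson])
    show "sigma_finite_measure (link_intensity t)"
      by (subst sigma_finite_measure.sigma_finite_iff_density_finite[OF lborel.sigma_finite_measure_axioms]) auto
  qed auto
  ultimately show "expectation (\<lambda>\<omega>. exp_minus (?S \<omega>)) =
      exp_minus (\<integral>\<^sup>+x. ennreal (1 - \<phi> x) \<partial>link_intensity t)"
    unfolding eq g using LIMSEQ_unique by fastforce
qed

text \<open>\<open>Mg = mg\<close> is possible, hence the split of the range into \<open>{Mg}\<close> and \<open>{mg} - {Mg}\<close>.\<close>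

lemma nn_integral_gain:
  assumes \<theta>: "0 < \<theta>" "\<theta> \<le> 2 * pi"
  shows "(\<integral>\<^sup>+\<omega>. f (G t l \<omega>) \<partial>P) =
    (\<Sum>n=1..2. ennreal (gain_prob \<theta> n) * f (gain_value Mg mg n))"
proof -
  have p: "0 \<le> gain_prob \<theta> n" for n
    using \<theta> by (simp add: gain_prob_def)
  have sum: "(\<Sum>n=1..2. F n) = F 1 + F 2" for F :: "nat \<Rightarrow> 'x :: comm_monoid_add"
    by (simp add: numeral_2_eq_2)
  have Gm [measurable]: "G t l \<in> borel_measurable P"
    by (rule measurable_source_algebra_P[OF G_measurable[of _ _ "{Gain t l}"]]) (auto simp: sources_def)
  have em: "emeasure P (G t l -` A \<inter> space P) =
      ennreal (gain_prob \<theta> 1) * indicator A Mg + ennreal (gain_prob \<theta> 2) * indicator A mg"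
    if "A \<in> sets borel" for A
    using gain_distribution[OF that, of t l] p
    unfolding emeasure_eq_measure sum
    by (simp add: gain_value_def indicator_def ennreal_plus)
  \<comment> \<open>The two gain probabilities sum to 1, which concentrates the gain on its two
    values.\<close>
  have "prob (G t l -` {Mg, mg} \<inter> space P) = 1"
    by (subst gain_distribution) (simp_all add: sum gain_value_def gain_prob_def del: One_nat_def)
  then have AE_G: "AE \<omega> in P. G t l \<omega> \<in> {Mg, mg}"
    by (subst (asm) prob_eq_1) auto
  have "(\<integral>\<^sup>+\<omega>. f (G t l \<omega>) \<partial>P) =
      (\<integral>\<^sup>+\<omega>. f Mg * indicator (G t l -` {Mg} \<inter> space P) \<omega> +
        f mg * indicator (G t l -` ({mg} - {Mg}) \<inter> space P) \<omega> \<partial>P)"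
    by (intro nn_integral_cong_AE, use AE_G AE_space in eventually_elim) (auto simp: indicator_def)
  also have "\<dots> = f Mg * emeasure P (G t l -` {Mg} \<inter> space P) +
      f mg * emeasure P (G t l -` ({mg} - {Mg}) \<inter> space P)"
    by (subst nn_integral_add) (auto simp: nn_integral_cmult_indicator)
  also have "\<dots> = (\<Sum>n=1..2. ennreal (gain_prob \<theta> n) * f (gain_value Mg mg n))"
    unfolding sum by (subst (1 2) em) (auto simp: gain_value_def indicator_def distrib_left mult.commute)
  finally show ?thesis .
qed

section \<open>Transforms of the fading and of a single mark\<close>

lemma fading_laplace:
  assumes "N t > 0" and c: "c \<ge> 0"
  shows "(\<integral>\<^sup>+\<omega>. ennreal (exp (- max 0 (c * H t l \<omega>))) \<partial>P) = ennreal (1 - nakagami_F (N t) c)"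
  using distributed_nn_integral[OF fading_distributed[of t l], of "\<lambda>x. ennreal (exp (- max 0 (c * x)))"]
    gamma_laplace[OF assms] by (simp add: nakagami_F_def)

lemma serving_fading_laplace:
  assumes "k \<in> {1..K}" "N LOS > 0" and c: "c \<ge> 0"
  shows "(\<integral>\<^sup>+\<omega>. ennreal (exp (- max 0 (c * h k \<omega>))) \<partial>P) = ennreal (1 - nakagami_F (N LOS) c)"
  using distributed_nn_integral[OF serving_fading_distributed[of k], of "\<lambda>x. ennreal (exp (- max 0 (c * x)))"]
    gamma_laplace[OF assms(2,3)] assms(1) by (simp add: nakagami_F_def)

text \<open>The gamma density vanishes outside the positive half-line. This gives the nonnegative
  signal power that the logarithm formula requires.\<close>

lemma serving_fading_pos:
  assumes "k \<in> {1..K}"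
  shows "AE \<omega> in P. h k \<omega> > 0"
proof -
  have "AE x in lborel. 0 < ennreal (gamma_density (N LOS) (1 / N LOS) x) \<longrightarrow> 0 < x"
    by (auto simp: gamma_density_def)
  then show ?thesis
    using distributed_AE2[OF serving_fading_distributed[OF assms], of "\<lambda>x. 0 < x"] by simp
qed

lemma nakagami_F_bounds:
  assumes "n > 0" "x \<ge> 0"
  shows "0 \<le> nakagami_F n x" "nakagami_F n x < 1"
proof -
  have "1 + x / n \<ge> 1"
    using assms by simp
  then have "1 \<le> (1 + x / n) powr n"
    using assms by (intro ge_one_powr_ge_zero) auto
  then show "0 \<le> nakagami_F n x" "nakagami_F n x < 1"
    by (auto simp: nakagami_F_def divide_le_eq)
qed

text \<open>Gain and fading of one label are different sources: with the gain frozen, the fading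
  contributes a gamma transform, which is then averaged over the two gain values.\<close>

lemma marks_laplace:
  assumes \<theta>: "0 < \<theta>" "\<theta> \<le> 2 * pi" and pos: "Mg > 0" "mg > 0" "N t > 0" "c \<ge> 0"
  shows "(\<integral>\<^sup>+\<omega>. ennreal (exp (- max 0 (c * (G t l \<omega> * H t l \<omega>)))) \<partial>P) =
    ennreal (\<Sum>n=1..2. gain_prob \<theta> n * (1 - nakagami_F (N t) (c * gain_value Mg mg n)))"
proof -
  define f where "f = (\<lambda>(\<omega>, z). ennreal (exp (- max 0 (c * (G t l \<omega> * z)))))"
  have [measurable]: "G t l \<in> borel_measurable (source_algebra {Gain t l})"
    by (rule G_measurable) simp
  have "(\<integral>\<^sup>+\<omega>. ennreal (exp (- max 0 (c * (G t l \<omega> * H t l \<omega>)))) \<partial>P) =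
      (\<integral>\<^sup>+\<omega>. f (\<omega>, H t l \<omega>) \<partial>P)"
    by (simp add: f_def)
  also have "\<dots> = (\<integral>\<^sup>+\<omega>. (\<integral>\<^sup>+\<omega>'. f (\<omega>, H t l \<omega>') \<partial>P) \<partial>P)"
  proof (rule nn_integral_indep_source)
    show "H t l \<in> borel_measurable (source_algebra {Fading t l})"
      by (rule H_measurable) simp
    show "f \<in> borel_measurable (source_algebra {Gain t l} \<Otimes>\<^sub>M borel)"
      unfolding f_def split_beta by measurable
  qed (auto simp: sources_def)
  also have "\<dots> = (\<Sum>n=1..2. ennreal (gain_prob \<theta> n) *
      (\<integral>\<^sup>+\<omega>'. ennreal (exp (- max 0 (c * (gain_value Mg mg n * H t l \<omega>')))) \<partial>P))"
    unfolding f_def split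
    using nn_integral_gain[OF \<theta>, of "\<lambda>g. \<integral>\<^sup>+\<omega>'. ennreal (exp (- max 0 (c * (g * H t l \<omega>')))) \<partial>P" t l] .
  also have "\<dots> = (\<Sum>n=1..2. ennreal (gain_prob \<theta> n * (1 - nakagami_F (N t) (c * gain_value Mg mg n))))"
  proof (rule sum.cong)
    fix n
    have "0 \<le> c * gain_value Mg mg n"
      using pos by (simp add: gain_value_def)
    then show "ennreal (gain_prob \<theta> n) *
        (\<integral>\<^sup>+\<omega>'. ennreal (exp (- max 0 (c * (gain_value Mg mg n * H t l \<omega>')))) \<partial>P) =
        ennreal (gain_prob \<theta> n * (1 - nakagami_F (N t) (c * gain_value Mg mg n)))"
      using fading_laplace[of t "c * gain_value Mg mg n" l] \<theta> pos
      by (simp add: gain_prob_def ennreal_mult' mult.assoc)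
  qed simp
  also have "\<dots> = ennreal (\<Sum>n=1..2. gain_prob \<theta> n * (1 - nakagami_F (N t) (c * gain_value Mg mg n)))"
    using \<theta> pos by (intro sum_ennreal mult_nonneg_nonneg)
      (auto simp: gain_prob_def gain_value_def intro!: less_imp_le[OF nakagami_F_bounds(2)])
  finally show ?thesis .
qed

end

section \<open>Capacity\<close>

locale nakagami_network = virtual_cell_network +
  fixes \<alpha> C :: "link \<Rightarrow> real" and \<sigma> :: real
  assumes lam_pos: "lam > 0" and K_pos: "K \<ge> 1" and \<beta>_pos: "\<beta> > 0"
    and C_pos: "\<And>t. C t > 0" and N_pos: "\<And>t. N t > 0"
    and Mg_pos: "Mg > 0" and mg_pos: "mg > 0" and \<theta>_pos: "0 < \<theta>" and \<theta>_le: "\<theta> \<le> 2 * pi"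
    and \<sigma>_pos: "\<sigma>\<^sup>2 > 0"
begin

abbreviation "QI \<equiv> Q_integral lam \<beta> K \<alpha> C Mg mg \<theta> N"

abbreviation "interf \<equiv> interference K \<alpha> C X G H"

abbreviation "cond_cap \<equiv> cond_capacity P K \<alpha> C Mg \<sigma> X h G H"

section \<open>The loss per interferer and the exponents \<open>Q_integral\<close>\<close>

lemma gain_prob_nonneg: "0 \<le> gain_prob \<theta> n"
  using \<theta>_pos \<theta>_le by (simp add: gain_prob_def)

lemma gain_value_pos: "0 < gain_value Mg mg n"
  using Mg_pos mg_pos by (simp add: gain_value_def)

lemma link_prob_nonneg: "0 \<le> x \<Longrightarrow> 0 \<le> link_prob \<beta> t x"
  using \<beta>_pos by (cases t) auto

lemma nakagami_F_measurable [measurable]: "nakagami_F n \<in> borel_measurable borel"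
  unfolding nakagami_F_def by measurable

text \<open>One minus the Laplace transform at \<open>s\<close> of the power received from an
  interferer at distance \<open>x\<close>; the integrand behind \<open>Q_integral\<close>.\<close>

definition mark_loss :: "link \<Rightarrow> real \<Rightarrow> real \<Rightarrow> real" where
  "mark_loss t s x = (\<Sum>n=1..2. gain_prob \<theta> n * nakagami_F (N t) (s * gain_value Mg mg n * C t * x powr (- \<alpha> t)))"

lemma mark_loss_measurable [measurable]: "mark_loss t s \<in> borel_measurable borel"
  unfolding mark_loss_def by measurable

lemma one_minus_mark_loss:
  "(\<Sum>n=1..2. gain_prob \<theta> n * (1 - nakagami_F (N t) (s * gain_value Mg mg n * C t * x powr (- \<alpha> t)))) =
    1 - mark_loss t s x"
  by (simp add: mark_loss_def numeral_2_eq_2 gain_prob_def algebra_simps)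

text \<open>The strict upper bound is the point: it keeps \<phi> positive in
  \<open>marked_laplace\<close>.\<close>

lemma mark_loss_bounds:
  assumes "s > 0"
  shows "0 \<le> mark_loss t s x" "mark_loss t s x < 1"
proof -
  let ?F = "\<lambda>n. nakagami_F (N t) (s * gain_value Mg mg n * C t * x powr (- \<alpha> t))"
  have "0 \<le> s * gain_value Mg mg n * C t * x powr (- \<alpha> t)" for n
    using assms gain_value_pos[of n] C_pos[of t] by simp
  then have F: "0 \<le> ?F n" "?F n < 1" for n
    by (auto intro: nakagami_F_bounds N_pos)
  show "0 \<le> mark_loss t s x"
    unfolding mark_loss_def by (intro sum_nonneg mult_nonneg_nonneg gain_prob_nonneg F)
  have "0 < (\<Sum>n=1..2. gain_prob \<theta> n * (1 - ?F n))"
  proof (rule sum_pos2)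
    \<comment> \<open>Strictness comes from the main lobe, since \<open>\<theta> > 0\<close>; the
      sidelobe probability vanishes when \<open>\<theta> = 2 * pi\<close>.\<close>
    show "0 < gain_prob \<theta> 1 * (1 - ?F 1)"
      using F[of 1] \<theta>_pos by (simp add: gain_prob_def)
    show "0 \<le> gain_prob \<theta> n * (1 - ?F n)" for n
      using F[of n] by (intro mult_nonneg_nonneg gain_prob_nonneg) simp
  qed auto
  then show "mark_loss t s x < 1"
    unfolding one_minus_mark_loss by simp
qed

text \<open>Intensity and loss depend on the distance only, so polar coordinates apply; they supply
  the factor \<open>2 * pi * x\<close>. As \<open>r K > 0\<close>, the condition
  \<open>x > r K\<close> absorbs the restriction to positive radii.\<close>

lemma Q_integral_eq:
  assumes "s > 0" and r: "r K > 0"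
  shows "(\<integral>\<^sup>+x. ennreal (1 - (if norm x > r K then 1 - mark_loss t s (norm x) else 1)) \<partial>link_intensity t) =
    QI t r s"
proof -
  let ?F = "\<lambda>n x. nakagami_F (N t) (s * gain_value Mg mg n * C t * x powr (- \<alpha> t))"
  define f where "f x = ennreal (lam * link_prob \<beta> t x) * ennreal (if x > r K then mark_loss t s x else 0)" for x
  have [measurable]: "f \<in> borel_measurable borel"
    unfolding f_def by measurable
  have "0 \<le> s * gain_value Mg mg n * C t * x powr (- \<alpha> t)" for n x
    using assms gain_value_pos[of n] C_pos[of t] by simp
  then have F: "0 \<le> ?F n x" for n x
    by (rule nakagami_F_bounds(1)[OF N_pos])
  have "(\<integral>\<^sup>+x. ennreal (1 - (if norm x > r K then 1 - mark_loss t s (norm x) else 1)) \<partial>link_intensity t) =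
      (\<integral>\<^sup>+x. f (norm (x :: real ^ 2)) \<partial>lborel)"
    by (subst nn_integral_density) (auto simp: f_def intro!: nn_integral_cong)
  also have "\<dots> = (\<integral>\<^sup>+x\<in>{0<..}. ennreal (2 * pi * x) * f x \<partial>lborel)"
    by (rule nn_integral_polar_plane) measurable
  also have "\<dots> = (\<integral>\<^sup>+x. ennreal (2 * pi * lam) * (\<Sum>n=1..2. ennreal (gain_prob \<theta> n) *
      (ennreal (?F n x * link_prob \<beta> t x * x) * indicator {r K<..} x)) \<partial>lborel)"
  proof (rule nn_integral_cong)
    fix x :: real
    show "ennreal (2 * pi * x) * f x * indicator {0<..} x =
        ennreal (2 * pi * lam) * (\<Sum>n=1..2. ennreal (gain_prob \<theta> n) *
          (ennreal (?F n x * link_prob \<beta> t x * x) * indicator {r K<..} x))"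
    proof (cases "x > r K")
      case True
      then have x: "x > 0"
        using r by simp
      have p: "0 \<le> link_prob \<beta> t x"
        using x by (intro link_prob_nonneg) simp
      have "ennreal (2 * pi * x) * f x * indicator {0<..} x =
          ennreal (2 * pi * x * (lam * link_prob \<beta> t x) * mark_loss t s x)"
        using True x p lam_pos mark_loss_bounds[OF assms(1), of t x]
        by (simp add: f_def ennreal_mult mult.assoc)
      also have "2 * pi * x * (lam * link_prob \<beta> t x) * mark_loss t s x =
          2 * pi * lam * (\<Sum>n=1..2. gain_prob \<theta> n * (?F n x * link_prob \<beta> t x * x))"
        unfolding mark_loss_def sum_distrib_left by (simp add: mult_ac)
      also have "ennreal \<dots> = ennreal (2 * pi * lam) *
          (\<Sum>n=1..2. ennreal (gain_prob \<theta> n) * ennreal (?F n x * link_prob \<beta> t x * x))"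
        using x p F lam_pos gain_prob_nonneg
        by (subst ennreal_mult) (auto simp: sum_nonneg simp flip: sum_ennreal ennreal_mult)
      finally show ?thesis
        using True by simp
    qed (simp add: f_def)
  qed
  also have "\<dots> = QI t r s"
    unfolding Q_integral_def
    by (subst nn_integral_cmult, measurable, subst nn_integral_sum, measurable)
      (simp add: nn_integral_cmult)
  finally show ?thesis .
qed

lemma interference_laplace:
  assumes s: "s > 0" and r: "r K > 0"
  shows "(\<lambda>\<omega>. ennreal s * interf t r \<omega>)
      \<in> borel_measurable (source_algebra ({Points t} \<union> range (Gain t) \<union> range (Fading t)))"
    and "expectation (\<lambda>\<omega>. exp_minus (ennreal s * interf t r \<omega>)) =
      exp_minus (QI t r s)"
proof -
  \<comment> \<open>The factor \<open>s\<close> is absorbed into the weight. Points in the disc get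
    weight 0 and transform 1, so the process on the whole plane can be used as it is.\<close>
  define w where "w x z = (if norm x > r K then ennreal (s * C t * norm x powr (- \<alpha> t) * z) else 0)"
    for x :: "real ^ 2" and z
  define \<phi> where "\<phi> x = (if norm x > r K then 1 - mark_loss t s (norm x) else 1)" for x :: "real ^ 2"
  have eq: "ennreal s * interf t r \<omega> =
      (\<Sum>l. case X t l \<omega> of None \<Rightarrow> 0 | Some x \<Rightarrow> w x (G t l \<omega> * H t l \<omega>))" for \<omega>
    unfolding interference_def ennreal_suminf_cmult[symmetric]
    using s by (intro suminf_cong) (auto simp: w_def mult_ac simp flip: ennreal_mult' split: option.split)
  have w: "case_prod w \<in> borel_measurable (borel \<Otimes>\<^sub>M borel)"
    unfolding w_def split_beta by measurable
  have \<phi>: "\<phi> \<in> borel_measurable borel"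
    unfolding \<phi>_def by measurable
  have \<phi>_bounds: "0 < \<phi> x" "\<phi> x \<le> 1" for x
    using mark_loss_bounds[OF s] by (auto simp: \<phi>_def)
  have \<phi>_eq: "(\<integral>\<^sup>+\<omega>. ennreal (exp_minus (w x (G t l \<omega> * H t l \<omega>))) \<partial>P) = ennreal (\<phi> x)" for l x
  proof (cases "norm x > r K")
    case True
    define c where "c = s * C t * norm x powr (- \<alpha> t)"
    have "c \<ge> 0"
      using s C_pos[of t] by (simp add: c_def)
    from marks_laplace[OF \<theta>_pos \<theta>_le Mg_pos mg_pos N_pos this, of t l]
    have "(\<integral>\<^sup>+\<omega>. ennreal (exp_minus (w x (G t l \<omega> * H t l \<omega>))) \<partial>P) =
        ennreal (\<Sum>n=1..2. gain_prob \<theta> n * (1 - nakagami_F (N t) (c * gain_value Mg mg n)))"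
      using True by (simp add: w_def c_def exp_minus_ennreal)
    also have "(\<Sum>n=1..2. gain_prob \<theta> n * (1 - nakagami_F (N t) (c * gain_value Mg mg n))) = \<phi> x"
      using one_minus_mark_loss[of t s "norm x"] True by (simp add: \<phi>_def c_def mult_ac)
    finally show ?thesis .
  qed (simp add: w_def \<phi>_def emeasure_space_1)
  note marked_laplace[OF w \<phi> \<phi>_bounds \<phi>_eq]
  then show "(\<lambda>\<omega>. ennreal s * interf t r \<omega>)
      \<in> borel_measurable (source_algebra ({Points t} \<union> range (Gain t) \<union> range (Fading t)))"
    "expectation (\<lambda>\<omega>. exp_minus (ennreal s * interf t r \<omega>)) =
      exp_minus (QI t r s)"
    unfolding eq Q_integral_eq[where r = r, OF assms, symmetric] by (simp_all add: \<phi>_def)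
qed

lemma interference_measurable [measurable]:
  assumes "r K > 0"
  shows "interf t r \<in> borel_measurable P"
proof -
  \<comment> \<open>The preceding measurability result at \<open>s = 1\<close>.\<close>
  have "(\<lambda>\<omega>. ennreal 1 * interf t r \<omega>) \<in> borel_measurable P"
    by (rule measurable_source_algebra_P[OF interference_laplace(1)])
      (use assms in \<open>auto simp: sources_def\<close>)
  then show ?thesis
    by simp
qed

text \<open>The factor with \<open>1 -\<close> is not a product over independent sources, but the
  whole expression is a difference of two such products: interference alone, and interference
  together with the signal.\<close>

lemma expectation_interference_signal:
  assumes s: "s > 0" and r: "r K > 0"
    and c: "\<And>k. k \<in> {1..K} \<Longrightarrow> c k \<ge> 0"
  shows "expectation (\<lambda>\<omega>. exp_minus (ennreal s * (interf LOS r \<omega> + interf NLOS r \<omega>)) *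
      (1 - (\<Prod>k=1..K. exp (- max 0 (c k * h k \<omega>))))) =
    exp_minus (QI LOS r s + QI NLOS r s) *
      (1 - (\<Prod>k=1..K. 1 - nakagami_F (N LOS) (c k)))"
proof -
  \<comment> \<open>Each interference field is grouped with its own gains and fadings, while every
    serving fading forms a group by itself; \<open>Points t\<close> and
    \<open>Serving_Fading k\<close> serve as names of the groups.\<close>
  define I where "I i = (case i of Points t \<Rightarrow> {Points t} \<union> range (Gain t) \<union> range (Fading t) | _ \<Rightarrow> {i})" for i
  define Y where "Y i \<omega> = (case i of
      Points t \<Rightarrow> exp_minus (ennreal s * interf t r \<omega>)
    | Serving_Fading k \<Rightarrow> exp (- max 0 (c k * h k \<omega>)))" for i \<omega>
  define T where "T = {Points LOS, Points NLOS}"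
  define S where "S = Serving_Fading ` {1..K}"
  have fin: "finite T" "finite S" "T \<inter> S = {}"
    by (auto simp: T_def S_def)
  have Ym: "Y j \<in> borel_measurable (source_algebra (I j))" if "j \<in> T \<union> S" for j
  proof -
    have "?thesis" if "j = Points t" for t
    proof -
      have "(\<lambda>\<omega>. exp_minus (ennreal s * interf t r \<omega>)) \<in> borel_measurable
          (source_algebra ({Points t} \<union> range (Gain t) \<union> range (Fading t)))"
        by (rule measurable_compose[OF interference_laplace(1)[where r = r, OF s r]]) simp
      then show ?thesis
        unfolding Y_def I_def that source.case .
    qed
    moreover have "?thesis" if "j = Serving_Fading k" for k
    proof -
      have [measurable]: "h k \<in> borel_measurable (source_algebra {Serving_Fading k})"
        by (rule h_measurable) simp
      show ?thesis
        unfolding Y_def I_def that by simp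
    qed
    ultimately show ?thesis
      using that unfolding T_def S_def by blast
  qed
  have sub: "(\<Union>j\<in>T \<union> S. I j) \<subseteq> sources"
    by (auto simp: T_def S_def I_def sources_def)
  have ind: "indep_vars (\<lambda>_. borel) Y (T \<union> S)"
  proof (rule indep_vars_source_algebras[OF _ sub Ym])
    show "disjoint_family_on I (T \<union> S)"
      by (auto simp: disjoint_family_on_def T_def S_def I_def)
  qed
  have YP: "Y j \<in> borel_measurable P" if "j \<in> T \<union> S" for j
    using measurable_source_algebra_P[OF Ym[OF that]] sub that by blast
  have Yb: "0 \<le> Y j \<omega>" "Y j \<omega> \<le> 1" if "j \<in> T \<union> S" for j \<omega>
    using that by (auto simp: Y_def T_def S_def)
  have int: "integrable P (Y j)" if "j \<in> T \<union> S" for j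
    using YP[OF that] Yb[OF that] by (intro integrable_const_bound[of _ 1]) auto
  have prod_T: "(\<Prod>j\<in>T. Y j \<omega>) =
      exp_minus (ennreal s * (interf LOS r \<omega> + interf NLOS r \<omega>))" for \<omega>
    by (simp add: T_def Y_def distrib_left exp_minus_add)
  have prod_S: "(\<Prod>j\<in>S. g j) = (\<Prod>k=1..K. g (Serving_Fading k))" for g :: "source \<Rightarrow> real"
    unfolding S_def by (subst prod.reindex) (auto simp: inj_on_def)
  have ET: "expectation (\<lambda>\<omega>. \<Prod>j\<in>T. Y j \<omega>) = (\<Prod>j\<in>T. expectation (Y j))"
    "integrable P (\<lambda>\<omega>. \<Prod>j\<in>T. Y j \<omega>)"
    using indep_vars_subset[OF ind, of T] fin int
    by (auto intro!: indep_vars_lebesgue_integral indep_vars_integrable)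
  have ETS: "expectation (\<lambda>\<omega>. \<Prod>j\<in>T \<union> S. Y j \<omega>) = (\<Prod>j\<in>T \<union> S. expectation (Y j))"
    "integrable P (\<lambda>\<omega>. \<Prod>j\<in>T \<union> S. Y j \<omega>)"
    using ind fin int by (auto intro!: indep_vars_lebesgue_integral indep_vars_integrable)
  have ES: "expectation (Y (Serving_Fading k)) = 1 - nakagami_F (N LOS) (c k)" if k: "k \<in> {1..K}" for k
  proof -
    have "(\<integral>\<^sup>+\<omega>. ennreal (Y (Serving_Fading k) \<omega>) \<partial>P) = ennreal (1 - nakagami_F (N LOS) (c k))"
      using serving_fading_laplace[OF k N_pos c[OF k]] by (simp add: Y_def)
    moreover have "0 \<le> 1 - nakagami_F (N LOS) (c k)"
      using nakagami_F_bounds[OF N_pos c[OF k], of LOS] by simp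
    moreover have "Serving_Fading k \<in> T \<union> S"
      using k by (simp add: S_def)
    ultimately show ?thesis
      using Yb YP by (subst integral_eq_nn_integral) auto
  qed
  have EQ: "(\<Prod>j\<in>T. expectation (Y j)) =
      exp_minus (QI LOS r s + QI NLOS r s)"
  proof -
    have "expectation (Y (Points t)) = exp_minus (QI t r s)" for t
      using interference_laplace(2)[where r = r, OF s r] by (simp add: Y_def[abs_def])
    then show ?thesis
      by (simp add: T_def exp_minus_add)
  qed
  have "expectation (\<lambda>\<omega>. exp_minus (ennreal s * (interf LOS r \<omega> + interf NLOS r \<omega>)) *
      (1 - (\<Prod>k=1..K. exp (- max 0 (c k * h k \<omega>))))) =
      expectation (\<lambda>\<omega>. (\<Prod>j\<in>T. Y j \<omega>) - (\<Prod>j\<in>T \<union> S. Y j \<omega>))"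
    unfolding prod.union_disjoint[OF fin] prod_T prod_S
    by (simp add: right_diff_distrib Y_def)
  also have "\<dots> = (\<Prod>j\<in>T. expectation (Y j)) - (\<Prod>j\<in>T \<union> S. expectation (Y j))"
    by (simp only: Bochner_Integration.integral_diff[OF ET(2) ETS(2)] ET(1) ETS(1))
  also have "\<dots> = (\<Prod>j\<in>T. expectation (Y j)) * (1 - (\<Prod>k=1..K. 1 - nakagami_F (N LOS) (c k)))"
    unfolding prod.union_disjoint[OF fin] prod_S using ES by (simp add: right_diff_distrib)
  finally show ?thesis
    unfolding EQ .
qed

section \<open>From transforms to capacity\<close>

definition capacity_integral :: "(nat \<Rightarrow> real) \<Rightarrow> ennreal" where
  "capacity_integral r = (\<integral>\<^sup>+s\<in>{0<..}. ennreal (exp (- s * \<sigma>\<^sup>2) / s *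
     exp_minus (QI LOS r s + QI NLOS r s) *
     (1 - (\<Prod>k=1..K. 1 - nakagami_F (N LOS) (s * Mg * C LOS * r k powr (- \<alpha> LOS))))) \<partial>lborel)"

text \<open>For finite \<open>I\<close> this is the integral for the logarithm at
  \<open>a = I + \<sigma>\<^sup>2\<close>. For infinite \<open>I\<close> both sides vanish: the
  convention that the SINR is 0 matches \<open>exp_minus \<top> = 0\<close>.\<close>

lemma log_sinr_eq:
  fixes I :: ennreal
  assumes "S \<ge> 0"
  shows "ennreal (ln (1 + (if I = \<infinity> then 0 else S / (enn2real I + \<sigma>\<^sup>2)))) =
    (\<integral>\<^sup>+s\<in>{0<..}. ennreal (exp (- s * \<sigma>\<^sup>2) / s * (exp_minus (ennreal s * I) * (1 - exp (- s * S)))) \<partial>lborel)"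
proof (cases I)
  case (real i)
  have "ennreal (ln (1 + S / (i + \<sigma>\<^sup>2))) =
      (\<integral>\<^sup>+s\<in>{0<..}. ennreal (exp (- s * (i + \<sigma>\<^sup>2)) / s * (1 - exp (- s * S))) \<partial>lborel)"
    using real \<sigma>_pos assms by (intro ln_one_plus_eq_nn_integral add_nonneg_pos)
  also have "\<dots> = (\<integral>\<^sup>+s\<in>{0<..}. ennreal (exp (- s * \<sigma>\<^sup>2) / s * (exp_minus (ennreal s * I) * (1 - exp (- s * S)))) \<partial>lborel)"
  proof (rule nn_integral_cong)
    fix s :: real
    have "exp_minus (ennreal s * I) = exp (- s * i)" if "s > 0"
      using that real by (simp add: exp_minus_ennreal max_def flip: ennreal_mult)
    moreover have "exp (- s * (i + \<sigma>\<^sup>2)) = exp (- s * \<sigma>\<^sup>2) * exp (- s * i)"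
      by (simp add: ring_distribs flip: exp_add)
    ultimately show "ennreal (exp (- s * (i + \<sigma>\<^sup>2)) / s * (1 - exp (- s * S))) * indicator {0<..} s =
        ennreal (exp (- s * \<sigma>\<^sup>2) / s * (exp_minus (ennreal s * I) * (1 - exp (- s * S)))) * indicator {0<..} s"
      by (auto simp: indicator_def mult.assoc)
  qed
  finally show ?thesis
    using real by simp
next
  case top
  have "(\<integral>\<^sup>+s\<in>{0<..}. ennreal (exp (- s * \<sigma>\<^sup>2) / s * (exp_minus (ennreal s * I) * (1 - exp (- s * S)))) \<partial>lborel) =
      (\<integral>\<^sup>+s. 0 \<partial>(lborel :: real measure))"
    by (rule nn_integral_cong) (auto simp: top indicator_def ennreal_mult_top)
  then show ?thesis
    using top by simp
qed

text \<open>Once the logarithm is an integral over \<open>s\<close>, everything is nonnegative, and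
  Tonelli reduces the claim to the expectation at each fixed \<open>s\<close>. Changing to base 2
  gives the constant \<open>1 / ln 2\<close>.\<close>

lemma cond_capacity_eq:
  assumes r: "\<And>k. k \<in> {1..K} \<Longrightarrow> r k > 0"
  shows "cond_cap r = ennreal (1 / ln 2) * capacity_integral r"
proof -
  have rK: "r K > 0"
    using r K_pos by simp
  note [measurable] = interference_measurable[where r = r, OF rK]
  have hm [measurable]: "h k \<in> borel_measurable P" if "k \<in> {1..K}" for k
    by (rule measurable_source_algebra_P[OF h_measurable[of _ "{Serving_Fading k}"]])
      (use that in \<open>auto simp: sources_def\<close>)
  define I where "I \<omega> = interf LOS r \<omega> + interf NLOS r \<omega>" for \<omega>
  define c where "c k = Mg * C LOS * r k powr (- \<alpha> LOS)" for k
  have c: "c k \<ge> 0" for k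
    using Mg_pos C_pos[of LOS] by (simp add: c_def)
  \<comment> \<open>The \<open>max 0\<close> places \<open>D\<close> in [0, 1] in every outcome and
    for every real \<open>s\<close>, which gives integrability directly.\<close>
  define D where "D s \<omega> = exp_minus (ennreal s * I \<omega>) * (1 - (\<Prod>k=1..K. exp (- max 0 (s * c k * h k \<omega>))))" for s \<omega>
  have [measurable]: "I \<in> borel_measurable P"
    unfolding I_def by measurable
  have D_bounds: "0 \<le> D s \<omega>" "D s \<omega> \<le> 1" for s \<omega>
  proof -
    have "(\<Prod>k=1..K. exp (- max 0 (s * c k * h k \<omega>))) \<in> {0..1}"
      by (auto intro!: prod_nonneg prod_le_1)
    then show "0 \<le> D s \<omega>" "D s \<omega> \<le> 1"
      unfolding D_def by (auto intro!: mult_nonneg_nonneg mult_le_one)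
  qed
  have Dm [measurable]: "(\<lambda>z. D (fst z) (snd z)) \<in> borel_measurable (borel \<Otimes>\<^sub>M P)"
  proof -
    have "(\<lambda>z. \<Prod>k=1..K. exp (- max 0 (fst z * c k * h k (snd z)))) \<in> borel_measurable (borel \<Otimes>\<^sub>M P)"
      by (rule borel_measurable_prod) measurable
    then show ?thesis
      unfolding D_def by measurable
  qed
  have "(\<lambda>z. (snd z, fst z)) \<in> P \<Otimes>\<^sub>M lborel \<rightarrow>\<^sub>M borel \<Otimes>\<^sub>M P"
    by measurable
  from measurable_compose[OF this Dm]
  have [measurable]: "(\<lambda>z. D (snd z) (fst z)) \<in> borel_measurable (P \<Otimes>\<^sub>M lborel)"
    by simp
  interpret pair_sigma_finite lborel P ..
  \<comment> \<open>On this almost sure event and for \<open>s > 0\<close> the \<open>max 0\<close>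
    has no effect, so the product in \<open>D\<close> is \<open>exp (- s * S)\<close> for the true
    signal power \<open>S\<close>.\<close>
  have pos: "AE \<omega> in P. \<forall>k\<in>{1..K}. h k \<omega> > 0"
    using serving_fading_pos by (intro AE_finite_allI) auto
  have "cond_cap r =
      (\<integral>\<^sup>+\<omega>. ennreal (1 / ln 2) *
        (\<integral>\<^sup>+s\<in>{0<..}. ennreal (exp (- s * \<sigma>\<^sup>2) / s * D s \<omega>) \<partial>lborel) \<partial>P)"
    unfolding cond_capacity_def
  proof (rule nn_integral_cong_AE, use pos in eventually_elim)
    fix \<omega> assume h: "\<forall>k\<in>{1..K}. h k \<omega> > 0"
    define S where "S = (\<Sum>k=1..K. c k * h k \<omega>)"
    have S: "S \<ge> 0"
      unfolding S_def using h c by (intro sum_nonneg mult_nonneg_nonneg) (auto intro: less_imp_le)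
    have sinr: "sinr K \<alpha> C Mg \<sigma> X h G H r \<omega> = (if I \<omega> = \<infinity> then 0 else S / (enn2real (I \<omega>) + \<sigma>\<^sup>2))"
      by (simp add: sinr_def Let_def I_def S_def c_def)
    have "0 \<le> ln (1 + sinr K \<alpha> C Mg \<sigma> X h G H r \<omega>)"
      unfolding sinr using S \<sigma>_pos by auto
    then have "ennreal (log 2 (1 + sinr K \<alpha> C Mg \<sigma> X h G H r \<omega>)) =
        ennreal (1 / ln 2) * ennreal (ln (1 + sinr K \<alpha> C Mg \<sigma> X h G H r \<omega>))"
      by (simp add: log_def flip: ennreal_mult')
    also have "ennreal (ln (1 + sinr K \<alpha> C Mg \<sigma> X h G H r \<omega>)) =
        (\<integral>\<^sup>+s\<in>{0<..}. ennreal (exp (- s * \<sigma>\<^sup>2) / s * (exp_minus (ennreal s * I \<omega>) * (1 - exp (- s * S)))) \<partial>lborel)"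
      unfolding sinr by (rule log_sinr_eq[OF S])
    also have "\<dots> = (\<integral>\<^sup>+s\<in>{0<..}. ennreal (exp (- s * \<sigma>\<^sup>2) / s * D s \<omega>) \<partial>lborel)"
    proof (rule nn_integral_cong)
      fix s :: real
      have "exp (- s * S) = (\<Prod>k=1..K. exp (- max 0 (s * c k * h k \<omega>)))" if "s > 0"
      proof -
        have "exp (- s * S) = (\<Prod>k=1..K. exp (- s * (c k * h k \<omega>)))"
          unfolding S_def sum_distrib_left by (rule exp_sum) simp
        also have "\<dots> = (\<Prod>k=1..K. exp (- max 0 (s * c k * h k \<omega>)))"
          using that c h by (intro prod.cong) (auto simp: max_def mult.assoc not_le zero_le_mult_iff less_imp_le)
        finally show ?thesis .
      qed
      then show "ennreal (exp (- s * \<sigma>\<^sup>2) / s * (exp_minus (ennreal s * I \<omega>) * (1 - exp (- s * S)))) * indicator {0<..} s =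
          ennreal (exp (- s * \<sigma>\<^sup>2) / s * D s \<omega>) * indicator {0<..} s"
        by (auto simp: D_def indicator_def)
    qed
    finally show "ennreal (log 2 (1 + sinr K \<alpha> C Mg \<sigma> X h G H r \<omega>)) =
        ennreal (1 / ln 2) * (\<integral>\<^sup>+s\<in>{0<..}. ennreal (exp (- s * \<sigma>\<^sup>2) / s * D s \<omega>) \<partial>lborel)" .
  qed
  also have "\<dots> = ennreal (1 / ln 2) *
      (\<integral>\<^sup>+\<omega>. (\<integral>\<^sup>+s\<in>{0<..}. ennreal (exp (- s * \<sigma>\<^sup>2) / s * D s \<omega>) \<partial>lborel) \<partial>P)"
    by (rule nn_integral_cmult) measurable
  also have "(\<integral>\<^sup>+\<omega>. (\<integral>\<^sup>+s\<in>{0<..}. ennreal (exp (- s * \<sigma>\<^sup>2) / s * D s \<omega>) \<partial>lborel) \<partial>P) =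
      (\<integral>\<^sup>+s. (\<integral>\<^sup>+\<omega>. ennreal (exp (- s * \<sigma>\<^sup>2) / s * D s \<omega>) * indicator {0<..} s \<partial>P) \<partial>lborel)"
    by (rule Fubini') measurable
  also have "\<dots> = capacity_integral r"
    unfolding capacity_integral_def
  proof (rule nn_integral_cong)
    fix s :: real
    show "(\<integral>\<^sup>+\<omega>. ennreal (exp (- s * \<sigma>\<^sup>2) / s * D s \<omega>) * indicator {0<..} s \<partial>P) =
        ennreal (exp (- s * \<sigma>\<^sup>2) / s *
          exp_minus (QI LOS r s + QI NLOS r s) *
          (1 - (\<Prod>k=1..K. 1 - nakagami_F (N LOS) (s * Mg * C LOS * r k powr (- \<alpha> LOS))))) * indicator {0<..} s"
    proof (cases "s > 0")
      case True
      have "(\<lambda>\<omega>. (s, \<omega>)) \<in> P \<rightarrow>\<^sub>M borel \<Otimes>\<^sub>M P"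
        by measurable
      from measurable_compose[OF this Dm] have Ds: "D s \<in> borel_measurable P"
        by simp
      have "integrable P (D s)"
        using Ds D_bounds by (intro integrable_const_bound[of _ 1]) auto
      then have "(\<integral>\<^sup>+\<omega>. ennreal (exp (- s * \<sigma>\<^sup>2) / s * D s \<omega>) \<partial>P) =
          ennreal (exp (- s * \<sigma>\<^sup>2) / s * expectation (D s))"
        using True D_bounds by (subst nn_integral_eq_integral) auto
      also have "expectation (D s) =
          exp_minus (QI LOS r s + QI NLOS r s) *
          (1 - (\<Prod>k=1..K. 1 - nakagami_F (N LOS) (s * c k)))"
        unfolding D_def I_def
        by (rule expectation_interference_signal[where r = r, OF True rK]) (use True c in auto)
      finally show ?thesis
        using True by (simp add: c_def mult.assoc)
    qed simp
  qed
  finally show ?thesis .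
qed

lemma ordered_dists_pos:
  assumes "r \<in> ordered_dists K" "k \<in> {1..K}"
  shows "r k > 0"
proof -
  have "r 1 \<le> r k"
    using assms K_pos by (auto simp: ordered_dists_def)
  moreover have "0 < r 1"
    using assms by (simp add: ordered_dists_def)
  ultimately show ?thesis
    by linarith
qed

text \<open>On \<open>ordered_dists K\<close> all distances are positive, so the conditional formula
  can be inserted; elsewhere the density is 0.\<close>

lemma ergodic_capacity_eq:
  "ergodic_capacity P K \<alpha> C Mg \<sigma> AP X h G H = ennreal ((2 * pi * lam) ^ K / ln 2) *
    (\<integral>\<^sup>+r\<in>ordered_dists K. ennreal ((\<Prod>k=1..K. r k) * exp (- pi * lam * (r K)\<^sup>2)) *
      capacity_integral r \<partial>dist_space K)"
proof -
  define B where "B = (2 * pi * lam) ^ K"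
  have B: "B > 0"
    using lam_pos by (simp add: B_def)
  have [measurable]: "(\<lambda>r. ennreal (dist_density lam K r)) \<in> borel_measurable (dist_space K)"
    using dists_distributed by (rule distributed_borel_measurable)
  note [measurable] = cond_capacity_measurable[OF K_pos]
  \<comment> \<open>The computation starts from the right-hand side: the constant is pulled out of
    an integrand built from \<open>cond_cap\<close>, whose measurability in \<open>r\<close> is
    supplied by \<open>cond_capacity_measurable\<close>. The factor \<open>ln 2 / B\<close> undoes
    \<open>1 / ln 2\<close> from the conditional formula and \<open>B\<close> from the
    density.\<close>
  have "(\<integral>\<^sup>+r\<in>ordered_dists K. ennreal ((\<Prod>k=1..K. r k) * exp (- pi * lam * (r K)\<^sup>2)) *
      capacity_integral r \<partial>dist_space K) =
      (\<integral>\<^sup>+r. ennreal (ln 2 / B) * (ennreal (dist_density lam K r) * cond_cap r) \<partial>dist_space K)"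
  proof (rule nn_integral_cong)
    fix r
    show "ennreal ((\<Prod>k=1..K. r k) * exp (- pi * lam * (r K)\<^sup>2)) * capacity_integral r * indicator (ordered_dists K) r =
        ennreal (ln 2 / B) * (ennreal (dist_density lam K r) * cond_cap r)"
    proof (cases "r \<in> ordered_dists K")
      case True
      define d where "d = (\<Prod>k=1..K. r k) * exp (- pi * lam * (r K)\<^sup>2)"
      have "d > 0"
        unfolding d_def using ordered_dists_pos[OF True] by (intro mult_pos_pos prod_pos) auto
      have "dist_density lam K r = B * d"
        using True by (simp add: dist_density_def B_def d_def)
      moreover have "ennreal (ln 2 / B) * (ennreal (B * d) * (ennreal (1 / ln 2) * J)) = ennreal d * J" for J
        using \<open>d > 0\<close> B by (simp add: mult.assoc[symmetric] flip: ennreal_mult)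
      ultimately show ?thesis
        using True cond_capacity_eq[OF ordered_dists_pos[OF True]] by (simp add: d_def)
    qed (simp add: dist_density_def)
  qed
  also have "\<dots> = ennreal (ln 2 / B) * ergodic_capacity P K \<alpha> C Mg \<sigma> AP X h G H"
    unfolding ergodic_capacity_eq_integral[OF K_pos] by (rule nn_integral_cmult) measurable
  finally have eq: "(\<integral>\<^sup>+r\<in>ordered_dists K. ennreal ((\<Prod>k=1..K. r k) * exp (- pi * lam * (r K)\<^sup>2)) *
      capacity_integral r \<partial>dist_space K) = ennreal (ln 2 / B) * ergodic_capacity P K \<alpha> C Mg \<sigma> AP X h G H" .
  show ?thesis
    unfolding eq B_def[symmetric] using B by (simp add: mult.assoc[symmetric] flip: ennreal_mult)
qed

end

theorem theorem1:
  fixes P :: "'w measure"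
    and lam \<beta> Mg mg \<theta> \<sigma> :: real and K :: nat
    and \<alpha> C N :: "link \<Rightarrow> real"
    and AP :: "nat \<Rightarrow> 'w \<Rightarrow> real ^ 2"
    and X :: "link \<Rightarrow> nat \<Rightarrow> 'w \<Rightarrow> (real ^ 2) option"
    and h :: "nat \<Rightarrow> 'w \<Rightarrow> real"
    and G H :: "link \<Rightarrow> nat \<Rightarrow> 'w \<Rightarrow> real"
  defines "Q \<equiv> Q_integral lam \<beta> K \<alpha> C Mg mg \<theta> N"
  assumes "lam > 0" and "K \<ge> 1" and "\<beta> > 0"
    and "\<And>t. \<alpha> t > 0" and "\<And>t. C t > 0" and "\<And>t. N t > 0"
    and "Mg > 0" and "mg > 0" and "0 < \<theta>" and "\<theta> \<le> 2 * pi" and "\<sigma>\<^sup>2 > 0"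
    and "virtual_cell_network P lam \<beta> K Mg mg \<theta> N AP X h G H"
  shows "(\<forall>r\<in>ordered_dists K.
            cond_capacity P K \<alpha> C Mg \<sigma> X h G H r =
            ennreal (1 / ln 2) *
            (\<integral>\<^sup>+s\<in>{0<..}. ennreal (exp (- s * \<sigma>\<^sup>2) / s * exp_minus (Q LOS r s + Q NLOS r s) *
               (1 - (\<Prod>k=1..K. 1 - nakagami_F (N LOS) (s * Mg * C LOS * r k powr (- \<alpha> LOS)))))
             \<partial>lborel)) \<and>
         ergodic_capacity P K \<alpha> C Mg \<sigma> AP X h G H =
         ennreal ((2 * pi * lam) ^ K / ln 2) *
         (\<integral>\<^sup>+r\<in>ordered_dists K. ennreal ((\<Prod>k=1..K. r k) * exp (- pi * lam * (r K)\<^sup>2)) *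
            (\<integral>\<^sup>+s\<in>{0<..}. ennreal (exp (- s * \<sigma>\<^sup>2) / s * exp_minus (Q LOS r s + Q NLOS r s) *
               (1 - (\<Prod>k=1..K. 1 - nakagami_F (N LOS) (s * Mg * C LOS * r k powr (- \<alpha> LOS)))))
             \<partial>lborel) \<partial>dist_space K)"
proof -
  interpret virtual_cell_network P lam \<beta> K Mg mg \<theta> N AP X h G H
    by fact
  interpret nakagami_network P lam \<beta> K Mg mg \<theta> N AP X h G H \<alpha> C \<sigma>
    by unfold_locales fact+
  have "r k > 0" if "r \<in> ordered_dists K" "k \<in> {1..K}" for r k
    using ordered_dists_pos that .
  then show ?thesis
    unfolding Q_def using cond_capacity_eq ergodic_capacity_eq
    by (simp add: capacity_integral_def)
qed

end
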